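(* Let $\varphi\colon\mathbb{R}^n\to\mathbb{R}$ be of class $\mathcal{C}^{1,1}$ around $\bar x$, where $\nabla\varphi(\bar x)=0$. Suppose that: (a) there is a neighborhood $U'\times V'$ of $(\bar x,0)$ such that for every $x\in U'$ with $\nabla\varphi(x)\in V'$ there exists $d\in\mathbb{R}^n$ satisfying $-\nabla\varphi(x)\in\partial^2\varphi(x)(d)$; (b) $\nabla\varphi$ is metrically regular around $(\bar x,0)$; (c) $\nabla\varphi$ is semismooth$^*$ at $(\bar x,0)$. Then there exists a neighborhood $U$ of $\bar x$ such that for all $x^0\in U$ the following algorithm is well-defined and generates a sequence $\{x^k\}$ that converges $Q$-superlinearly to $\bar x$, i.e., $x^k\to\bar x$ and $$\lim_{k\to\infty}\frac{\|x^{k+1}-\bar x\|}{\|x^k-\bar x\|}=0.$$ Algorithm: starting from $x^0$, for $k=0,1,\ldots$: if $\nabla\varphi(x^k)=0$, stop; otherwise choose $d^k\in\mathbb{R}^n$ satisfying $-\nabla\varphi(x^k)\in\partial\langle d^k,\nabla\varphi\rangle(x^k)$ and set $x^{k+1}:=x^k+d^k$.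
   Context: $\varphi$ is of class $\mathcal{C}^{1,1}$ around $\bar x$ if it is continuously differentiable with Lipschitz continuous gradient on a neighborhood of $\bar x$. "Well-defined" means that at each non-terminal iterate a direction $d^k$ as required exists; $d^k$ may be any such direction. If the algorithm stops at some $x^k$, convergence is understood as $x^k=\bar x$. For $\Omega\subset\mathbb{R}^s$ and $\bar z\in\Omega$: $\widehat N_\Omega(\bar z)=\{v:\limsup_{z\to\bar z,\,z\in\Omega}\frac{\langle v,z-\bar z\rangle}{\|z-\bar z\|}\le 0\}$ is the regular normal cone; $N_\Omega(\bar z)=\{v:\exists\, z_k\to\bar z,\ z_k\in\Omega,\ v_k\to v,\ v_k\in\widehat N_\Omega(z_k)\}$ is the limiting normal cone; and for $d\in\mathbb{R}^s$, $N_\Omega(\bar z;d)=\{v:\exists\,t_k\downarrow0,\ d_k\to d,\ v_k\to v,\ v_k\in\widehat N_\Omega(\bar z+t_kd_k)\}$ is the directional limiting normal cone. For $F\colon\mathbb{R}^n\rightrightarrows\mathbb{R}^m$ and $(x,y)\in\mathrm{gph}\,F$, the limiting coderivative is $D^*F(x,y)(v)=\{u:(u,-v)\in N_{\mathrm{gph}\,F}(x,y)\}$ ($y$ is omitted if $F$ is single-valued), and the directional limiting coderivative in the direction $(u,v)$ is $D^*F((x,y);(u,v))(v^* )=\{u^*:(u^*,-v^* )\in N_{\mathrm{gph}\,F}((x,y);(u,v))\}$. For a real-valued $\psi$, $\partial\psi(x)=\{v:(v,-1)\in N_{\mathrm{epi}\,\psi}(x,\psi(x))\}$ is the limiting subdifferential,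 and $\langle d,\nabla\varphi\rangle$ is the function $x\mapsto\langle d,\nabla\varphi(x)\rangle$. For $\varphi$ of class $\mathcal{C}^{1,1}$ around $x$, $\partial^2\varphi(x)(d)=(D^*\nabla\varphi)(x)(d)=\partial\langle d,\nabla\varphi\rangle(x)$. $F$ is metrically regular around $(\bar x,\bar y)\in\mathrm{gph}\,F$ if there are $\mu>0$ and neighborhoods $U$ of $\bar x$, $V$ of $\bar y$ with $\mathrm{dist}(x;F^{-1}(y))\le\mu\,\mathrm{dist}(y;F(x))$ for all $(x,y)\in U\times V$ (distance to the empty set is $\infty$). $F$ is semismooth$^*$ at $(\bar x,\bar y)\in\mathrm{gph}\,F$ if for every $(u,v)\in\mathbb{R}^n\times\mathbb{R}^m$ one has $\langle u^*,u\rangle=\langle v^*,v\rangle$ for all $(v^*,u^* )\in\mathrm{gph}\,D^*F((\bar x,\bar y);(u,v))$. *)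

theory Defs
  imports "HOL-Analysis.Analysis"
begin

text \<open>Outside \<open>\<Omega>\<close> the regular normal cone is empty. At an isolated point of \<open>\<Omega>\<close> the filter below is
  trivial, so the upper limit is \<open>-\<infinity>\<close> and the cone is the whole space.\<close>

definition regular_normal_cone :: "'a::real_inner set \<Rightarrow> 'a \<Rightarrow> 'a set" where
  "regular_normal_cone \<Omega> z =
     {v. z \<in> \<Omega> \<and>
         Limsup (at z within \<Omega>) (\<lambda>w. ereal (inner v (w - z) / norm (w - z))) \<le> 0}"

definition limiting_normal_cone :: "'a::real_inner set \<Rightarrow> 'a \<Rightarrow> 'a set" where
  "limiting_normal_cone \<Omega> z =
     {v. \<exists>zs vs. zs \<longlonglongrightarrow> z \<and> (\<forall>k. zs k \<in> \<Omega>) \<and> vs \<longlonglongrightarrow> v \<and>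
                 (\<forall>k::nat. vs k \<in> regular_normal_cone \<Omega> (zs k))}"

text \<open>As usual in variational analysis, \<open>t\<^sub>k \<down> 0\<close> means that \<open>t\<^sub>k\<close> tends to \<open>0\<close> through positive
  values; passing to a subsequence shows that requiring monotonicity would not change the cone.\<close>

definition directional_normal_cone :: "'a::real_inner set \<Rightarrow> 'a \<Rightarrow> 'a \<Rightarrow> 'a set" where
  "directional_normal_cone \<Omega> z d =
     {v. \<exists>t ds vs. (\<forall>k. 0 < t k) \<and> t \<longlonglongrightarrow> (0::real) \<and> ds \<longlonglongrightarrow> d \<and> vs \<longlonglongrightarrow> v \<and>
                   (\<forall>k::nat. vs k \<in> regular_normal_cone \<Omega> (z + t k *\<^sub>R ds k))}"

definition gph :: "('a \<Rightarrow> 'b set) \<Rightarrow> ('a \<times> 'b) set" where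
  "gph F = {(x, y). y \<in> F x}"

definition coderivative ::
  "('a::real_inner \<Rightarrow> 'b::real_inner set) \<Rightarrow> 'a \<times> 'b \<Rightarrow> 'b \<Rightarrow> 'a set" where
  "coderivative F z v = {u. (u, - v) \<in> limiting_normal_cone (gph F) z}"

definition directional_coderivative ::
  "('a::real_inner \<Rightarrow> 'b::real_inner set) \<Rightarrow> 'a \<times> 'b \<Rightarrow> 'a \<times> 'b \<Rightarrow> 'b \<Rightarrow> 'a set" where
  "directional_coderivative F z w v = {u. (u, - v) \<in> directional_normal_cone (gph F) z w}"

text \<open>Distance to a set with \<open>dist(x; \<emptyset>) = \<infinity>\<close> (the library's \<^const>\<open>infdist\<close> gives \<open>0\<close> there).\<close>

definition set_distance :: "'a::metric_space \<Rightarrow> 'a set \<Rightarrow> ereal" where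
  "set_distance x A = (INF a\<in>A. ereal (dist x a))"

definition metrically_regular ::
  "('a::metric_space \<Rightarrow> 'b::metric_space set) \<Rightarrow> 'a \<Rightarrow> 'b \<Rightarrow> bool" where
  "metrically_regular F xbar ybar \<longleftrightarrow>
     ybar \<in> F xbar \<and>
     (\<exists>\<mu>>0. \<exists>U V. open U \<and> xbar \<in> U \<and> open V \<and> ybar \<in> V \<and>
        (\<forall>x\<in>U. \<forall>y\<in>V. set_distance x {x'. y \<in> F x'} \<le> ereal \<mu> * set_distance y (F x)))"

definition semismooth_star ::
  "('a::real_inner \<Rightarrow> 'b::real_inner set) \<Rightarrow> 'a \<Rightarrow> 'b \<Rightarrow> bool" where
  "semismooth_star F xbar ybar \<longleftrightarrow>
     ybar \<in> F xbar \<and>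
     (\<forall>u v. \<forall>vs us. us \<in> directional_coderivative F (xbar, ybar) (u, v) vs \<longrightarrow>
        inner us u = inner vs v)"

definition gradient :: "('a::real_inner \<Rightarrow> real) \<Rightarrow> 'a \<Rightarrow> 'a" where
  "gradient \<phi> x = (THE g. GDERIV \<phi> x :> g)"

text \<open>The gradient as a set-valued mapping, empty where \<open>\<phi>\<close> is not differentiable. It is used
  for \<open>\<nabla>\<phi>\<close> in graphs and inverse images, so that the arbitrary values of \<^const>\<open>gradient\<close> at points of
  nondifferentiability never enter there.\<close>

definition gradient_map :: "('a::real_inner \<Rightarrow> real) \<Rightarrow> 'a \<Rightarrow> 'a set" where
  "gradient_map \<phi> x = {g. GDERIV \<phi> x :> g}"

definition C11_around :: "('a::real_inner \<Rightarrow> real) \<Rightarrow> 'a \<Rightarrow> bool" where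
  "C11_around \<phi> x \<longleftrightarrow>
     (\<exists>U. open U \<and> x \<in> U \<and> (\<forall>y\<in>U. \<phi> differentiable (at y)) \<and>
          continuous_on U (gradient \<phi>) \<and> (\<exists>L. L-lipschitz_on U (gradient \<phi>)))"

definition limiting_subdifferential :: "('a::real_inner \<Rightarrow> real) \<Rightarrow> 'a \<Rightarrow> 'a set" where
  "limiting_subdifferential \<psi> x =
     {v. (v, - 1) \<in> limiting_normal_cone (epigraph UNIV \<psi>) (x, \<psi> x)}"

definition second_subdifferential :: "('a::real_inner \<Rightarrow> real) \<Rightarrow> 'a \<Rightarrow> 'a \<Rightarrow> 'a set" where
  "second_subdifferential \<phi> x d = coderivative (gradient_map \<phi>) (x, gradient \<phi> x) d"

definition newton_direction :: "('a::real_inner \<Rightarrow> real) \<Rightarrow> 'a \<Rightarrow> 'a \<Rightarrow> bool" where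
  "newton_direction \<phi> x d \<longleftrightarrow>
     - gradient \<phi> x \<in> limiting_subdifferential (\<lambda>y. inner d (gradient \<phi> y)) x"

text \<open>The algorithm started at \<open>x0\<close> can perform its first \<open>N\<close> steps (all steps, if \<open>N = \<infinity>\<close>) with
  iterates \<open>x\<close> and directions \<open>d\<close>. Only \<open>x k\<close> with \<open>k \<le> N\<close> and \<open>d k\<close> with \<open>k < N\<close> are constrained.\<close>

definition newton_run ::
  "('a::real_inner \<Rightarrow> real) \<Rightarrow> 'a \<Rightarrow> (nat \<Rightarrow> 'a) \<Rightarrow> (nat \<Rightarrow> 'a) \<Rightarrow> enat \<Rightarrow> bool" where
  "newton_run \<phi> x0 x d N \<longleftrightarrow>
     x 0 = x0 \<and>
     (\<forall>k. enat k < N \<longrightarrow>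
        gradient \<phi> (x k) \<noteq> 0 \<and> newton_direction \<phi> (x k) (d k) \<and> x (Suc k) = x k + d k)"

text \<open>Whatever directions were chosen before, the algorithm does not get stuck: \<open>\<nabla>\<phi>\<close> exists and is
  Lipschitz near the current iterate, so that the stopping test and the subdifferential make
  sense there, and a direction exists unless the iterate is terminal.\<close>

definition newton_well_defined :: "('a::real_inner \<Rightarrow> real) \<Rightarrow> 'a \<Rightarrow> bool" where
  "newton_well_defined \<phi> x0 \<longleftrightarrow>
     (\<forall>x d. \<forall>K::nat. newton_run \<phi> x0 x d (enat K) \<longrightarrow>
        C11_around \<phi> (x K) \<and>
        (gradient \<phi> (x K) \<noteq> 0 \<longrightarrow> (\<exists>d'. newton_direction \<phi> (x K) d')))"

definition Q_superlinear :: "(nat \<Rightarrow> 'a::real_normed_vector) \<Rightarrow> 'a \<Rightarrow> bool" where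
  "Q_superlinear x xbar \<longleftrightarrow>
     x \<longlonglongrightarrow> xbar \<and> (\<lambda>k. norm (x (Suc k) - xbar) / norm (x k - xbar)) \<longlonglongrightarrow> 0"

end

theory Submission
  imports Defs
begin

text \<open>
  Write \<open>F = \<nabla>\<phi>\<close>, let \<open>h = x - xbar\<close>, and let \<open>d\<close> be a Newton direction at \<open>x\<close>, so that the error after the
  step is \<open>z = h + d\<close>. The heart of the matter is that \<open>\<parallel>z\<parallel> \<le> \<epsilon> \<parallel>h\<parallel>\<close> once \<open>x\<close> is close enough to
  \<open>xbar\<close>, for every \<open>\<epsilon> > 0\<close> and every choice of \<open>d\<close> (\<open>newton_contraction\<close>).

  Semismoothness\<open>\<^sup>*\<close> applied to the Newton inclusion itself controls only the number \<open>\<langle>F x, z\<rangle>\<close>.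
  If \<open>F\<close> were differentiable with Jacobian \<open>A\<close>, then semismoothness\<open>\<^sup>*\<close> would say \<open>A h = F x + o(\<parallel>h\<parallel>)\<close>, whereas
  the Newton inclusion reads \<open>A\<^sup>T d = - F x\<close>. As \<open>A\<close> is a Hessian it is symmetric, hence
  \<open>A z = o(\<parallel>h\<parallel>)\<close>, and metric regularity bounds \<open>\<parallel>z\<parallel>\<close> by a multiple of \<open>\<parallel>A z\<parallel>\<close>. Each of these steps has a
  version for merely Lipschitz \<open>F\<close> that avoids derivatives of \<open>F\<close>.

  By compactness, semismoothness\<open>\<^sup>*\<close> gives \<open>\<langle>u, h\<rangle> = \<langle>w, F x\<rangle> + o(\<parallel>h\<parallel>)\<close> uniformly for all regular
  subgradients \<open>u\<close> of \<open>\<langle>w, F\<rangle>\<close> at \<open>x\<close> and all unit vectors \<open>w\<close> (\<open>semismooth_star_uniform_estimate\<close>). A mean value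
  inequality turns this into \<open>F (y + t h) - F y = t F x + t o(\<parallel>h\<parallel>)\<close> for \<open>y\<close> near \<open>x\<close> and small \<open>t\<close>, the
  statement \<open>A h \<approx> F x\<close> (\<open>increments_along_ray\<close>). The left side is the gradient of
  \<open>y \<mapsto> \<phi> (y + t h) - \<phi> y\<close>; dividing by \<open>t\<close> and letting \<open>t \<rightarrow> 0\<close> shows that \<open>y \<mapsto> \<langle>h, F y\<rangle> - \<langle>F x, y\<rangle>\<close> has
  Lipschitz constant \<open>o(\<parallel>h\<parallel>)\<close> near \<open>x\<close>. This is \<open>A\<^sup>T h \<approx> F x\<close>, and \<open>lipschitz_directional_derivative\<close> thus
  plays the part of the symmetry of the Hessian. Adding the Newton inclusion, the function
  \<open>\<langle>z, F\<rangle>\<close> has almost vanishing slope of decrease at points near \<open>x\<close>, while metric regularity allows it to be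
  decreased at a rate of \<open>\<parallel>z\<parallel> / \<mu>\<close> by moving \<open>F\<close> in the direction \<open>- z\<close>. Comparing the rates bounds
  \<open>\<parallel>z\<parallel>\<close> (\<open>newton_step_bound\<close>).

  Everything else follows from the contraction. Iterates stay in a ball around \<open>xbar\<close> and converge
  superlinearly. A critical point in this ball admits the direction \<open>0\<close>, and the contraction forces it
  to be \<open>xbar\<close>. Directions exist because the coderivative of \<open>F\<close> is contained in the subdifferential
  of the scalarized function (\<open>coderivative_subset_subdifferential_scalarization\<close>).
\<close>

section \<open>Regular subgradients\<close>

text \<open>Also known as the Frechet subdifferential.\<close>

definition regular_subdifferential :: "('a::real_inner \<Rightarrow> real) \<Rightarrow> 'a \<Rightarrow> 'a set" where
  "regular_subdifferential f x =
     {v. \<forall>e>0. \<forall>\<^sub>F y in nhds x. f x + inner v (y - x) - e * norm (y - x) \<le> f y}"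

text \<open>The upper limit is at most \<open>0\<close> when every positive bound holds eventually. In this form the
  base point need not be excluded, where both sides vanish, and the estimate can be pulled back
  along any map that is continuous at the base point.\<close>

lemma regular_normal_cone_iff:
  "v \<in> regular_normal_cone \<Omega> z \<longleftrightarrow>
     z \<in> \<Omega> \<and> (\<forall>e>0. \<forall>\<^sub>F w in nhds z. w \<in> \<Omega> \<longrightarrow> inner v (w - z) \<le> e * norm (w - z))"
proof -
  have "(\<forall>y>0::ereal. \<forall>\<^sub>F w in at z within \<Omega>. ereal (inner v (w - z) / norm (w - z)) < y)
     \<longleftrightarrow> (\<forall>e>0. \<forall>\<^sub>F w in nhds z. w \<in> \<Omega> \<longrightarrow> inner v (w - z) \<le> e * norm (w - z))"
    (is "?L \<longleftrightarrow> ?R")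
  proof
    assume L: ?L
    show ?R
    proof (intro allI impI)
      fix e :: real assume "e > 0"
      then have "\<forall>\<^sub>F w in at z within \<Omega>. ereal (inner v (w - z) / norm (w - z)) < ereal e"
        using L[rule_format, of "ereal e"] by simp
      then show "\<forall>\<^sub>F w in nhds z. w \<in> \<Omega> \<longrightarrow> inner v (w - z) \<le> e * norm (w - z)"
        unfolding eventually_at_filter
        by eventually_elim (auto simp: divide_simps split: if_splits)
    qed
  next
    assume R: ?R
    show ?L
    proof (intro allI impI)
      fix y :: ereal assume "y > 0"
      then obtain e where e: "e > 0" "ereal e < y"
        by (metis dense ereal_dense2 ereal_less(2) less_ereal.simps(1))
      then have "\<forall>\<^sub>F w in nhds z. w \<in> \<Omega> \<longrightarrow> inner v (w - z) \<le> e * norm (w - z)"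
        using R by simp
      then show "\<forall>\<^sub>F w in at z within \<Omega>. ereal (inner v (w - z) / norm (w - z)) < y"
        unfolding eventually_at_filter
      proof eventually_elim
        case (elim w)
        show ?case
        proof (intro impI)
          assume "w \<noteq> z" "w \<in> \<Omega>"
          then have "inner v (w - z) / norm (w - z) \<le> e"
            using elim by (simp add: divide_simps)
          then show "ereal (inner v (w - z) / norm (w - z)) < y"
            using e(2) by (meson ereal_less_eq(3) order_le_less_trans)
        qed
      qed
    qed
  qed
  then show ?thesis
    by (simp add: regular_normal_cone_def Limsup_le_iff)
qed

text \<open>Both proofs below find subgradients at minimizers of \<open>f\<close> plus a quadratic; expanding the square
  there leaves exactly this kind of minorant.\<close>

lemma regular_subgradient_quadratic:
  assumes "\<forall>\<^sub>F y in nhds x. f x + inner v (y - x) - C * (norm (y - x))\<^sup>2 \<le> f y"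
  shows "v \<in> regular_subdifferential f x"
  unfolding regular_subdifferential_def
proof (intro CollectI allI impI)
  fix e :: real assume "e > 0"
  then have "\<forall>\<^sub>F y in nhds x. dist y x < e / (\<bar>C\<bar> + 1)"
    by (simp add: eventually_nhds_metric) (metis abs_ge_zero add_nonneg_pos divide_pos_pos zero_less_one)
  with assms show "\<forall>\<^sub>F y in nhds x. f x + inner v (y - x) - e * norm (y - x) \<le> f y"
  proof eventually_elim
    case (elim y)
    have "C * norm (y - x) \<le> \<bar>C\<bar> * norm (y - x)"
      by (simp add: mult_right_mono)
    also have "\<dots> \<le> (\<bar>C\<bar> + 1) * norm (y - x)"
      by (simp add: mult_right_mono)
    also have "\<dots> \<le> e"
      using elim(2) by (simp add: dist_norm field_simps)
    finally have "C * norm (y - x) * norm (y - x) \<le> e * norm (y - x)"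
      by (simp add: mult_right_mono)
    with elim(1) show ?case
      by (simp add: power2_eq_square)
  qed
qed

text \<open>Variational principle: an approximate subgradient at \<open>x\<close> becomes an exact one at a nearby point.
  Adding a multiple of \<open>\<parallel>y - x\<parallel>\<^sup>2\<close> to \<open>f - \<langle>v, \<cdot> - x\<rangle>\<close> forces a minimizer into the open ball, and the gradient of
  the penalty there is the error made in \<open>v\<close>.\<close>

lemma regular_subgradient_near_approximate:
  fixes f :: "'a::euclidean_space \<Rightarrow> real"
  assumes cont: "continuous_on (cball x r) f" and r: "0 < r" and c: "0 < c"
    and approx: "\<And>y. y \<in> cball x r \<Longrightarrow> f x + inner v (y - x) - c * norm (y - x) \<le> f y"
  obtains x' u where "dist x x' < r" "u \<in> regular_subdifferential f x'" "norm (u - v) \<le> 4 * c"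
proof -
  \<comment> \<open>On the sphere of radius \<open>r\<close> the penalty is \<open>2 c r\<close>, more than the possible decrease \<open>c r\<close>.\<close>
  define g where "g y = f y - inner v (y - x) + 2 * c / r * (norm (y - x))\<^sup>2" for y
  have "continuous_on (cball x r) g"
    unfolding g_def by (intro continuous_intros cont)
  then obtain x' where x': "x' \<in> cball x r" "\<And>y. y \<in> cball x r \<Longrightarrow> g x' \<le> g y"
    using continuous_attains_inf[of "cball x r" g] r by auto
  have "norm (x' - x) \<noteq> r"
  proof
    assume *: "norm (x' - x) = r"
    have "g x' \<le> f x"
      using x'(2)[of x] r by (simp add: g_def)
    moreover have "g x' \<ge> f x + c * r"
      using approx[OF x'(1)] * r by (simp add: g_def power2_eq_square)
    ultimately show False
      using mult_pos_pos[OF c r] by linarith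
  qed
  with x'(1) have near: "dist x x' < r"
    by (simp add: dist_norm norm_minus_commute)
  define u where "u = v - (4 * c / r) *\<^sub>R (x' - x)"
  have "\<forall>\<^sub>F y in nhds x'. y \<in> ball x r"
    using near by (intro eventually_nhds_in_open) auto
  then have "\<forall>\<^sub>F y in nhds x'. f x' + inner u (y - x') - (2 * c / r) * (norm (y - x'))\<^sup>2 \<le> f y"
  proof eventually_elim
    case (elim y)
    have "g x' \<le> g y"
      using x'(2)[of y] elim by simp
    moreover have "(norm (y - x))\<^sup>2 = (norm (x' - x))\<^sup>2 + 2 * inner (x' - x) (y - x') + (norm (y - x'))\<^sup>2"
      unfolding power2_norm_eq_inner
      by (simp add: inner_diff_left inner_diff_right inner_commute)
    ultimately have "f x' - inner v (x' - x) + 2 * c / r * (norm (x' - x))\<^sup>2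
        \<le> f y - inner v (y - x) + 2 * c / r * ((norm (x' - x))\<^sup>2 + 2 * inner (x' - x) (y - x') + (norm (y - x'))\<^sup>2)"
      by (simp add: g_def)
    moreover have "inner u (y - x') = inner v (y - x) - inner v (x' - x)
        - 2 * c / r * (2 * inner (x' - x) (y - x'))"
      unfolding u_def inner_diff_left inner_scaleR_left by (simp add: inner_diff_right)
    ultimately show ?case
      by (simp add: algebra_simps)
  qed
  then have "u \<in> regular_subdifferential f x'"
    by (rule regular_subgradient_quadratic)
  moreover have "norm (u - v) \<le> 4 * c"
  proof -
    have "norm (u - v) = 4 * c * (norm (x' - x) / r)"
      using r c by (simp add: u_def)
    also have "\<dots> \<le> 4 * c"
      using near r c by (intro mult_left_le) (auto simp: dist_norm norm_minus_commute)
    finally show ?thesis .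
  qed
  ultimately show ?thesis
    using that near by blast
qed

text \<open>A mean value inequality that needs no differentiability. If it failed, choose \<open>c'\<close> strictly between
  \<open>c\<close> and the increment and minimize \<open>f y - c' t + N \<parallel>y - (a + t h)\<parallel>\<^sup>2\<close> over \<open>t \<in> [0, 1]\<close> and \<open>y\<close> in a ball. For
  large \<open>N\<close> the minimizing \<open>y\<close> stays close to the segment, and \<open>t = 1\<close> is excluded because
  the value there exceeds the one at \<open>t = 0\<close>, \<open>y = a\<close>. Minimality in \<open>y\<close> makes
  \<open>u = - 2 N (y - a - t h)\<close> a subgradient; minimality in \<open>t\<close>, which may be increased, gives
  \<open>\<langle>u, h\<rangle> \<ge> c' > c\<close>.\<close>

lemma mean_value_regular_subgradients:
  fixes f :: "'a::euclidean_space \<Rightarrow> real"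
  assumes cont: "continuous_on (ball x R) f" and a: "a \<in> ball x R" and b: "a + h \<in> ball x R"
    and slope: "\<And>w u. w \<in> ball x R \<Longrightarrow> u \<in> regular_subdifferential f w \<Longrightarrow> inner u h \<le> c"
  shows "f (a + h) - f a \<le> c"
proof (rule ccontr)
  assume "\<not> f (a + h) - f a \<le> c"
  define c' where "c' = (c + (f (a + h) - f a)) / 2"
  have c': "c < c'" "f a + c' < f (a + h)"
    using \<open>\<not> f (a + h) - f a \<le> c\<close> by (auto simp: c'_def field_simps)
  define m where "m = max (dist x a) (dist x (a + h))"
  \<comment> \<open>The slightly smaller closed ball is compact and has the segment in its interior.\<close>
  define R' where "R' = (m + R) / 2"
  have R': "m < R'" "R' < R"
    using a b by (auto simp: m_def R'_def)
  have seg: "dist x (a + t *\<^sub>R h) \<le> m" if "t \<in> {0..1}" for t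
  proof -
    have "(1 - t) *\<^sub>R a + t *\<^sub>R (a + h) \<in> cball x m"
      by (intro convexD[OF convex_cball]) (use that in \<open>auto simp: m_def\<close>)
    then show ?thesis
      by (simp add: algebra_simps)
  qed
  have contK: "continuous_on (cball x R') f"
    by (rule continuous_on_subset[OF cont]) (use R' in auto)
  obtain M where M: "\<And>y. y \<in> cball x R' \<Longrightarrow> \<bar>f y\<bar> \<le> M"
    using compact_imp_bounded[OF compact_continuous_image[OF contK compact_cball]]
    unfolding bounded_iff by (metis image_eqI real_norm_def)
  have aK: "a \<in> cball x R'"
    using R' by (auto simp: m_def)
  have "(f \<longlongrightarrow> f (a + h)) (nhds (a + h))"
    using cont b by (simp add: continuous_on_eq_continuous_at isCont_def tendsto_at_iff_tendsto_nhds)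
  then have "\<forall>\<^sub>F y in nhds (a + h). f y > f a + c'"
    using c' by (intro order_tendstoD(1))
  then obtain s1 where s1: "s1 > 0" "\<And>y. dist y (a + h) < s1 \<Longrightarrow> f y > f a + c'"
    unfolding eventually_nhds_metric by blast
  define s where "s = min s1 (R' - m)"
  have s: "s > 0"
    using s1 R' by (simp add: s_def)
  have "M \<ge> 0"
    using M[OF aK] by linarith
  \<comment> \<open>With this \<open>N\<close> a distance \<open>\<ge> s\<close> from the segment would cost more than \<open>f\<close> and \<open>c' t\<close> can compensate.\<close>
  define N where "N = (2 * M + \<bar>c'\<bar> + 1) / s\<^sup>2"
  have N: "N > 0" "N * s\<^sup>2 = 2 * M + \<bar>c'\<bar> + 1"
    using s \<open>M \<ge> 0\<close> by (auto simp: N_def)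
  define \<Phi> where "\<Phi> = (\<lambda>(t, y). f y - c' * t + N * (norm (y - a - t *\<^sub>R h))\<^sup>2)"
  have "continuous_on ({0..1} \<times> cball x R') (\<lambda>p. f (snd p))"
    by (rule continuous_on_compose2[OF contK]) (auto intro!: continuous_intros)
  then have "continuous_on ({0..1} \<times> cball x R') \<Phi>"
    unfolding \<Phi>_def case_prod_beta by (intro continuous_intros) auto
  moreover have "compact ({0..1::real} \<times> cball x R')"
    by (intro compact_Times) auto
  moreover have "{0..1::real} \<times> cball x R' \<noteq> {}"
    using aK by (metis SigmaI atLeastAtMost_iff empty_iff order_refl zero_le_one)
  ultimately obtain p
    where p: "p \<in> {0..1} \<times> cball x R'" "\<And>q. q \<in> {0..1} \<times> cball x R' \<Longrightarrow> \<Phi> p \<le> \<Phi> q"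
    using continuous_attains_inf[of "{0..1} \<times> cball x R'" \<Phi>] by blast
  obtain t y where ty: "p = (t, y)" by (cases p)
  have t: "0 \<le> t" "t \<le> 1" and y: "y \<in> cball x R'"
    using p(1) ty by auto
  have min: "f y - c' * t + N * (norm (y - a - t *\<^sub>R h))\<^sup>2 \<le> f y' - c' * t' + N * (norm (y' - a - t' *\<^sub>R h))\<^sup>2"
    if "t' \<in> {0..1}" "y' \<in> cball x R'" for t' y'
    using p(2)[of "(t', y')"] that by (simp add: ty \<Phi>_def)
  have le_fa: "f y - c' * t + N * (norm (y - a - t *\<^sub>R h))\<^sup>2 \<le> f a"
    using min[of 0 a] aK by simp
  have "c' * t \<le> \<bar>c'\<bar>"
    using t by (metis abs_ge_self abs_le_iff abs_mult abs_of_nonneg mult_left_le order_trans abs_ge_zero)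
  then have "N * (norm (y - a - t *\<^sub>R h))\<^sup>2 < N * s\<^sup>2"
    using le_fa M[OF aK] M[OF y] N(2) by linarith
  then have close: "norm (y - a - t *\<^sub>R h) < s"
    using N(1) s by (simp add: power_less_imp_less_base)
  have "t \<noteq> 1"
  proof
    assume "t = 1"
    then have "f a + c' < f y"
      using close by (intro s1) (simp add: s_def dist_norm algebra_simps)
    moreover have "0 \<le> N * (norm (y - a - t *\<^sub>R h))\<^sup>2"
      using N by simp
    ultimately show False
      using le_fa \<open>t = 1\<close> by simp
  qed
  with t have "t < 1" by simp
  define u where "u = - (2 * N) *\<^sub>R (y - a - t *\<^sub>R h)"
  have "dist x y \<le> dist x (a + t *\<^sub>R h) + dist (a + t *\<^sub>R h) y"
    by (rule dist_triangle)
  also have "\<dots> < m + (R' - m)"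
    using seg[of t] t close by (intro add_le_less_mono) (auto simp: s_def dist_norm norm_minus_commute algebra_simps)
  finally have yin: "y \<in> ball x R'" by simp
  have "\<forall>\<^sub>F y' in nhds y. y' \<in> ball x R'"
    using yin by (intro eventually_nhds_in_open) auto
  then have "\<forall>\<^sub>F y' in nhds y. f y + inner u (y' - y) - N * (norm (y' - y))\<^sup>2 \<le> f y'"
  proof eventually_elim
    case (elim y')
    have eq: "y' - a - t *\<^sub>R h = (y - a - t *\<^sub>R h) + (y' - y)"
      by simp
    have "f y + N * (norm (y - a - t *\<^sub>R h))\<^sup>2 \<le> f y' + N * (norm (y' - a - t *\<^sub>R h))\<^sup>2"
      using min[of t y'] t elim by simp
    also have "(norm (y' - a - t *\<^sub>R h))\<^sup>2
        = (norm (y - a - t *\<^sub>R h))\<^sup>2 + 2 * inner (y - a - t *\<^sub>R h) (y' - y) + (norm (y' - y))\<^sup>2"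
      unfolding eq power2_norm_eq_inner inner_add_left inner_add_right
      by (simp add: inner_commute)
    finally show ?case
      unfolding u_def inner_scaleR_left by (simp add: algebra_simps)
  qed
  then have u: "u \<in> regular_subdifferential f y"
    by (rule regular_subgradient_quadratic)
  \<comment> \<open>A forward step in \<open>t\<close> so short that its quadratic term cannot close the gap between \<open>c\<close> and \<open>c'\<close>.\<close>
  define \<tau> where "\<tau> = min (1 - t) ((c' - c) / (2 * (N * (norm h)\<^sup>2 + 1)))"
  have Nh: "N * (norm h)\<^sup>2 \<ge> 0"
    using N by simp
  have \<tau>: "0 < \<tau>" "t + \<tau> \<le> 1"
    using \<open>t < 1\<close> c' Nh by (auto simp: \<tau>_def intro!: divide_pos_pos)
  have "\<tau> \<le> (c' - c) / (2 * (N * (norm h)\<^sup>2 + 1))"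
    by (simp add: \<tau>_def)
  then have "\<tau> * (2 * (N * (norm h)\<^sup>2 + 1)) \<le> c' - c"
    using Nh by (subst (asm) pos_le_divide_eq) auto
  then have \<tau>N: "\<tau> * (N * (norm h)\<^sup>2) < c' - c"
    using \<tau>(1) c'(1) Nh mult_nonneg_nonneg[of \<tau> "N * (norm h)\<^sup>2"] by (simp add: algebra_simps)
  have eq: "y - a - (t + \<tau>) *\<^sub>R h = (y - a - t *\<^sub>R h) - \<tau> *\<^sub>R h"
    by (simp add: algebra_simps)
  have "N * (norm (y - a - t *\<^sub>R h))\<^sup>2 \<le> - c' * \<tau> + N * (norm (y - a - (t + \<tau>) *\<^sub>R h))\<^sup>2"
    using min[of "t + \<tau>" y] t \<tau> y by (simp add: algebra_simps)
  also have "(norm (y - a - (t + \<tau>) *\<^sub>R h))\<^sup>2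
      = (norm (y - a - t *\<^sub>R h))\<^sup>2 - 2 * \<tau> * inner (y - a - t *\<^sub>R h) h + \<tau>\<^sup>2 * (norm h)\<^sup>2"
    unfolding eq power2_norm_eq_inner inner_diff_left[of _ "\<tau> *\<^sub>R h"] inner_diff_right[of _ _ "\<tau> *\<^sub>R h"]
    by (simp add: inner_commute power2_eq_square)
  finally have "0 \<le> \<tau> * (- c' + inner u h + \<tau> * (N * (norm h)\<^sup>2))"
    unfolding u_def inner_scaleR_left by (simp add: algebra_simps power2_eq_square)
  then have "c' \<le> inner u h + \<tau> * (N * (norm h)\<^sup>2)"
    using \<tau>(1) by (simp add: zero_le_mult_iff)
  moreover have "inner u h \<le> c"
    using slope[of y u] u yin R' by simp
  ultimately show False
    using \<tau>N by simp
qed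

section \<open>Subgradients, normals and coderivatives of Lipschitz mappings\<close>

lemma eventually_along_ray:
  fixes x u :: "'a::real_normed_vector"
  assumes "\<forall>\<^sub>F y in nhds x. P y"
  shows "\<forall>\<^sub>F t in at_right (0::real). P (x + t *\<^sub>R u)"
proof -
  have "((\<lambda>t. x + t *\<^sub>R u) \<longlongrightarrow> x + 0 *\<^sub>R u) (at_right 0)"
    by (intro tendsto_intros tendsto_ident_at)
  then show ?thesis
    using assms by (auto dest: eventually_compose_filterlim)
qed

lemma norm_regular_subgradient_le:
  assumes "L-lipschitz_on U f" "open U" "x \<in> U" "u \<in> regular_subdifferential f x"
  shows "norm u \<le> L"
proof (rule field_le_epsilon)
  fix e :: real assume "e > 0"
  have "\<forall>\<^sub>F y in nhds x. y \<in> U"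
    using assms by (intro eventually_nhds_in_open)
  moreover have "\<forall>\<^sub>F y in nhds x. f x + inner u (y - x) - e * norm (y - x) \<le> f y"
    using assms(4) \<open>e > 0\<close> by (simp add: regular_subdifferential_def)
  ultimately have "\<forall>\<^sub>F y in nhds x. inner u (y - x) \<le> (L + e) * norm (y - x)"
  proof eventually_elim
    case (elim y)
    then show ?case
      using lipschitz_onD[OF assms(1) elim(1) assms(3)]
      by (simp add: dist_norm algebra_simps abs_le_iff)
  qed
  then have "\<forall>\<^sub>F t in at_right 0. inner u (x + t *\<^sub>R u - x) \<le> (L + e) * norm (x + t *\<^sub>R u - x)"
    by (rule eventually_along_ray)
  moreover have "\<forall>\<^sub>F t in at_right (0::real). t > 0"
    by (simp add: eventually_at_right_less)
  ultimately have "\<forall>\<^sub>F t in at_right (0::real). norm u \<le> L + e"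
  proof eventually_elim
    case (elim t)
    then have "norm u * norm u \<le> (L + e) * norm u"
      by (simp add: power2_norm_eq_inner[symmetric] power2_eq_square)
    then show ?case
      using \<open>e > 0\<close> lipschitz_on_nonneg[OF assms(1)]
      by (cases "norm u = 0") auto
  qed
  then show "norm u \<le> L + e"
    by simp
qed

text \<open>For Lipschitz \<open>F\<close> the distance between points of the graph is comparable to the distance of their
  first components, so the two first-order estimates differ only by a constant factor.\<close>

lemma regular_normal_graph_iff:
  assumes G: "\<And>y. y \<in> U \<Longrightarrow> G y = {F y}" and U: "open U" "x \<in> U" and L: "L-lipschitz_on U F"
  shows "(u, - z) \<in> regular_normal_cone (gph G) (x, F x) \<longleftrightarrow>
           u \<in> regular_subdifferential (\<lambda>y. inner z (F y)) x" (is "?N \<longleftrightarrow> ?S")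
proof
  assume N: ?N
  show ?S
    unfolding regular_subdifferential_def
  proof (intro CollectI allI impI)
    fix e :: real assume "e > 0"
    have L0: "L \<ge> 0" using L by (rule lipschitz_on_nonneg)
    have "continuous_on U F" using L by (rule lipschitz_on_continuous_on)
    then have "((\<lambda>y. (y, F y)) \<longlongrightarrow> (x, F x)) (nhds x)"
      using U by (intro tendsto_intros)
        (auto simp: continuous_on_eq_continuous_at isCont_def tendsto_at_iff_tendsto_nhds filterlim_ident)
    moreover have "\<forall>\<^sub>F w in nhds (x, F x). w \<in> gph G \<longrightarrow>
        inner (u, - z) (w - (x, F x)) \<le> e / (1 + L) * norm (w - (x, F x))"
      using N[unfolded regular_normal_cone_iff, THEN conjunct2, rule_format, of "e / (1 + L)"] \<open>e > 0\<close> L0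
      by simp
    ultimately have "\<forall>\<^sub>F y in nhds x. (y, F y) \<in> gph G \<longrightarrow>
        inner (u, - z) ((y, F y) - (x, F x)) \<le> e / (1 + L) * norm ((y, F y) - (x, F x))"
      by (auto dest: eventually_compose_filterlim)
    moreover have "\<forall>\<^sub>F y in nhds x. y \<in> U"
      using U by (intro eventually_nhds_in_open)
    ultimately show "\<forall>\<^sub>F y in nhds x. inner z (F x) + inner u (y - x) - e * norm (y - x) \<le> inner z (F y)"
    proof eventually_elim
      case (elim y)
      have "norm (y - x, F y - F x) \<le> norm (y - x) + L * norm (y - x)"
        using norm_Pair_le[of "y - x" "F y - F x"] lipschitz_onD[OF L elim(2) U(2)]
        by (simp add: dist_norm)
      then have "e / (1 + L) * norm (y - x, F y - F x) \<le> e / (1 + L) * ((1 + L) * norm (y - x))"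
        using \<open>e > 0\<close> L0 by (intro mult_left_mono) (auto simp: algebra_simps)
      also have "\<dots> = e * norm (y - x)"
        using L0 by simp
      finally show ?case
        using elim by (simp add: gph_def G inner_diff_right)
    qed
  qed
next
  assume S: ?S
  show ?N
    unfolding regular_normal_cone_iff
  proof (intro conjI allI impI)
    show "(x, F x) \<in> gph G"
      using U by (simp add: gph_def G)
    fix e :: real assume "e > 0"
    have "(fst \<longlongrightarrow> x) (nhds (x, F x))"
      using tendsto_fst[OF filterlim_ident, of "(x, F x)"] by simp
    moreover have "\<forall>\<^sub>F y in nhds x. inner z (F x) + inner u (y - x) - e * norm (y - x) \<le> inner z (F y)"
      using S \<open>e > 0\<close> by (simp add: regular_subdifferential_def)
    moreover have "\<forall>\<^sub>F y in nhds x. y \<in> U"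
      using U by (intro eventually_nhds_in_open)
    ultimately have "\<forall>\<^sub>F w in nhds (x, F x). fst w \<in> U \<and>
        inner z (F x) + inner u (fst w - x) - e * norm (fst w - x) \<le> inner z (F (fst w))"
      by (intro eventually_conj) (auto dest: eventually_compose_filterlim)
    then show "\<forall>\<^sub>F w in nhds (x, F x). w \<in> gph G \<longrightarrow>
        inner (u, - z) (w - (x, F x)) \<le> e * norm (w - (x, F x))"
    proof eventually_elim
      case (elim w)
      have "e * norm (fst w - x) \<le> e * norm (w - (x, F x))"
        using \<open>e > 0\<close> norm_fst_le[of "fst w - x" "snd w - F x"] by (cases w) simp
      then show ?case
        using elim by (cases w) (auto simp: gph_def G inner_diff_right)
    qed
  qed
qed

text \<open>Points of the epigraph lie above the graph, which only decreases the inner product with a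
  normal pointing downwards.\<close>

lemma regular_normal_epigraph_of_subgradient:
  assumes "v \<in> regular_subdifferential f x"
  shows "(v, - 1) \<in> regular_normal_cone (epigraph UNIV f) (x, f x)"
  unfolding regular_normal_cone_iff
proof (intro conjI allI impI)
  show "(x, f x) \<in> epigraph UNIV f"
    by (simp add: mem_epigraph)
  fix e :: real assume "e > 0"
  have "(fst \<longlongrightarrow> x) (nhds (x, f x))"
    using tendsto_fst[OF filterlim_ident, of "(x, f x)"] by simp
  moreover have "\<forall>\<^sub>F y in nhds x. f x + inner v (y - x) - e * norm (y - x) \<le> f y"
    using assms \<open>e > 0\<close> by (simp add: regular_subdifferential_def)
  ultimately have "\<forall>\<^sub>F w in nhds (x, f x). f x + inner v (fst w - x) - e * norm (fst w - x) \<le> f (fst w)"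
    by (auto dest: eventually_compose_filterlim)
  then show "\<forall>\<^sub>F w in nhds (x, f x). w \<in> epigraph UNIV f \<longrightarrow>
      inner (v, - 1) (w - (x, f x)) \<le> e * norm (w - (x, f x))"
  proof eventually_elim
    case (elim w)
    have "e * norm (fst w - x) \<le> e * norm (w - (x, f x))"
      using \<open>e > 0\<close> norm_fst_le[of "fst w - x" "snd w - f x"] by (cases w) simp
    then show ?case
      using elim by (cases w) (auto simp: mem_epigraph)
  qed
qed

text \<open>The base point may lie strictly above the graph: the translate of the graph through
  \<open>(x, \<alpha>)\<close> stays in the epigraph, and testing the normal along this translate suffices.\<close>

lemma regular_subgradient_of_normal_epigraph:
  assumes L: "L-lipschitz_on U f" and U: "open U" "x \<in> U" and l: "l > 0"
    and N: "(v, - l) \<in> regular_normal_cone (epigraph UNIV f) (x, \<alpha>)"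
  shows "v /\<^sub>R l \<in> regular_subdifferential f x"
  unfolding regular_subdifferential_def
proof (intro CollectI allI impI)
  fix e :: real assume "e > 0"
  have L0: "L \<ge> 0" using L by (rule lipschitz_on_nonneg)
  have \<alpha>: "f x \<le> \<alpha>"
    using N by (simp add: regular_normal_cone_iff mem_epigraph)
  have "continuous_on U f" using L by (rule lipschitz_on_continuous_on)
  then have "((\<lambda>y. (y, \<alpha> + (f y - f x))) \<longlongrightarrow> (x, \<alpha> + (f x - f x))) (nhds x)"
    using U by (intro tendsto_intros)
      (auto simp: continuous_on_eq_continuous_at isCont_def tendsto_at_iff_tendsto_nhds filterlim_ident)
  moreover have "\<forall>\<^sub>F w in nhds (x, \<alpha>). w \<in> epigraph UNIV f \<longrightarrow>
      inner (v, - l) (w - (x, \<alpha>)) \<le> e * l / (1 + L) * norm (w - (x, \<alpha>))"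
    using N[unfolded regular_normal_cone_iff, THEN conjunct2, rule_format, of "e * l / (1 + L)"] \<open>e > 0\<close> L0 l
    by simp
  ultimately have "\<forall>\<^sub>F y in nhds x. (y, \<alpha> + (f y - f x)) \<in> epigraph UNIV f \<longrightarrow>
      inner (v, - l) ((y, \<alpha> + (f y - f x)) - (x, \<alpha>)) \<le> e * l / (1 + L) * norm ((y, \<alpha> + (f y - f x)) - (x, \<alpha>))"
    by (auto dest: eventually_compose_filterlim)
  moreover have "\<forall>\<^sub>F y in nhds x. y \<in> U"
    using U by (intro eventually_nhds_in_open)
  ultimately show "\<forall>\<^sub>F y in nhds x. f x + inner (v /\<^sub>R l) (y - x) - e * norm (y - x) \<le> f y"
  proof eventually_elim
    case (elim y)
    have "norm (y - x, f y - f x) \<le> norm (y - x) + L * norm (y - x)"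
      using norm_Pair_le[of "y - x" "f y - f x"] lipschitz_onD[OF L elim(2) U(2)]
      by (simp add: dist_norm)
    then have "e * l / (1 + L) * norm (y - x, f y - f x) \<le> e * l / (1 + L) * ((1 + L) * norm (y - x))"
      using \<open>e > 0\<close> L0 l by (intro mult_left_mono) (auto simp: algebra_simps)
    also have "\<dots> = e * l * norm (y - x)"
      using L0 by simp
    finally have "inner v (y - x) - l * (f y - f x) \<le> e * l * norm (y - x)"
      using elim \<alpha> by (simp add: mem_epigraph)
    then have "inner v (y - x) / l \<le> f y - f x + e * norm (y - x)"
      unfolding pos_divide_le_eq[OF l] by (simp add: algebra_simps)
    then show ?case
      by (simp add: divide_inverse_commute)
  qed
qed

text \<open>Normals close to \<open>(v, -1)\<close> point strictly downwards and can be rescaled to last component \<open>-1\<close>,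
  so limits of epigraph normals are limits of regular subgradients.\<close>

lemma limiting_subdifferential_iff_nearby:
  assumes L: "L-lipschitz_on U f" and U: "open U" "x \<in> U"
  shows "v \<in> limiting_subdifferential f x \<longleftrightarrow>
     (\<forall>\<eta>>0. \<exists>x' u. dist x' x < \<eta> \<and> dist u v < \<eta> \<and> u \<in> regular_subdifferential f x')"
    (is "?L \<longleftrightarrow> ?R")
proof
  assume ?L
  then obtain zs vs where zs: "zs \<longlonglongrightarrow> (x, f x)" and vs: "vs \<longlonglongrightarrow> (v, - 1)"
    and N: "\<And>k. vs k \<in> regular_normal_cone (epigraph UNIV f) (zs k)"
    unfolding limiting_subdifferential_def limiting_normal_cone_def by blast
  have x: "(\<lambda>k. fst (zs k)) \<longlonglongrightarrow> x" and v: "(\<lambda>k. fst (vs k)) \<longlonglongrightarrow> v" and l: "(\<lambda>k. - snd (vs k)) \<longlonglongrightarrow> 1"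
    using tendsto_fst[OF zs] tendsto_fst[OF vs] tendsto_minus[OF tendsto_snd[OF vs]] by auto
  have q: "(\<lambda>k. fst (vs k) /\<^sub>R (- snd (vs k))) \<longlonglongrightarrow> v"
    using tendsto_scaleR[OF tendsto_inverse[OF l] v] by simp
  show ?R
  proof (intro allI impI)
    fix \<eta> :: real assume "\<eta> > 0"
    have "\<forall>\<^sub>F k in sequentially. fst (zs k) \<in> U"
      using topological_tendstoD[OF x U] .
    moreover have "\<forall>\<^sub>F k in sequentially. - snd (vs k) > 0"
      using order_tendstoD(1)[OF l, of 0] by simp
    moreover have "\<forall>\<^sub>F k in sequentially. dist (fst (zs k)) x < \<eta>"
      using tendstoD[OF x \<open>\<eta> > 0\<close>] .
    moreover have "\<forall>\<^sub>F k in sequentially. dist (fst (vs k) /\<^sub>R (- snd (vs k))) v < \<eta>"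
      using tendstoD[OF q \<open>\<eta> > 0\<close>] .
    ultimately have "\<forall>\<^sub>F k in sequentially. fst (zs k) \<in> U \<and> - snd (vs k) > 0 \<and> dist (fst (zs k)) x < \<eta>
        \<and> dist (fst (vs k) /\<^sub>R (- snd (vs k))) v < \<eta>"
      by eventually_elim simp
    then obtain k where k: "fst (zs k) \<in> U" "- snd (vs k) > 0" "dist (fst (zs k)) x < \<eta>"
        "dist (fst (vs k) /\<^sub>R (- snd (vs k))) v < \<eta>"
      using eventually_happens'[OF sequentially_bot] by blast
    have "(fst (vs k), - (- snd (vs k))) \<in> regular_normal_cone (epigraph UNIV f) (fst (zs k), snd (zs k))"
      using N[of k] by simp
    from regular_subgradient_of_normal_epigraph[OF L U(1) k(1,2) this] k
    show "\<exists>x' u. dist x' x < \<eta> \<and> dist u v < \<eta> \<and> u \<in> regular_subdifferential f x'"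
      by blast
  qed
next
  assume R: ?R
  have "\<forall>k. \<exists>p. dist (fst p) x < inverse (real (Suc k)) \<and> dist (snd p) v < inverse (real (Suc k))
      \<and> snd p \<in> regular_subdifferential f (fst p)"
  proof
    fix k
    show "\<exists>p. dist (fst p) x < inverse (real (Suc k)) \<and> dist (snd p) v < inverse (real (Suc k))
      \<and> snd p \<in> regular_subdifferential f (fst p)"
      using R[rule_format, of "inverse (real (Suc k))"] by auto
  qed
  then obtain p where p: "\<And>k. dist (fst (p k)) x < inverse (real (Suc k))"
      "\<And>k. dist (snd (p k)) v < inverse (real (Suc k))"
      "\<And>k. snd (p k) \<in> regular_subdifferential f (fst (p k))"
    by metis
  have xs: "(\<lambda>k. fst (p k)) \<longlonglongrightarrow> x"
    by (rule metric_tendsto_imp_tendsto[OF LIMSEQ_inverse_real_of_nat])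
      (use p(1) in \<open>auto intro!: always_eventually less_imp_le simp: less_imp_le\<close>)
  have vs: "(\<lambda>k. snd (p k)) \<longlonglongrightarrow> v"
    by (rule metric_tendsto_imp_tendsto[OF LIMSEQ_inverse_real_of_nat])
      (use p(2) in \<open>auto intro!: always_eventually less_imp_le simp: less_imp_le\<close>)
  have "isCont f x"
    using lipschitz_on_continuous_on[OF L] U by (simp add: continuous_on_eq_continuous_at)
  then have "(\<lambda>k. f (fst (p k))) \<longlonglongrightarrow> f x"
    using xs by (rule isCont_tendsto_compose)
  then have "(\<lambda>k. (fst (p k), f (fst (p k)))) \<longlonglongrightarrow> (x, f x)"
    by (intro tendsto_Pair xs)
  moreover have "(\<lambda>k. (snd (p k), - 1 :: real)) \<longlonglongrightarrow> (v, - 1)"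
    by (intro tendsto_Pair vs tendsto_const)
  moreover have "(fst (p k), f (fst (p k))) \<in> epigraph UNIV f" for k
    by (simp add: mem_epigraph)
  moreover have "(snd (p k), - 1) \<in> regular_normal_cone (epigraph UNIV f) (fst (p k), f (fst (p k)))" for k
    using p(3) by (rule regular_normal_epigraph_of_subgradient)
  ultimately show ?L
    unfolding limiting_subdifferential_def limiting_normal_cone_def by blast
qed

lemma inner_lipschitz:
  assumes "L-lipschitz_on U F"
  shows "(norm z * L)-lipschitz_on U (\<lambda>y. inner z (F y))"
proof (rule lipschitz_onI)
  fix y y' assume "y \<in> U" "y' \<in> U"
  have "\<bar>inner z (F y - F y')\<bar> \<le> norm z * norm (F y - F y')"
    by (rule Cauchy_Schwarz_ineq2)
  also have "\<dots> \<le> norm z * (L * dist y y')"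
    using lipschitz_onD[OF assms \<open>y \<in> U\<close> \<open>y' \<in> U\<close>] by (intro mult_left_mono) (auto simp: dist_norm)
  finally show "dist (inner z (F y)) (inner z (F y')) \<le> norm z * L * dist y y'"
    by (simp add: dist_real_def inner_diff_right mult.assoc)
qed (use lipschitz_on_nonneg[OF assms] in simp)

text \<open>The half of the scalarization formula \<open>D\<^sup>*F(x)(d) = \<partial>\<langle>d, F\<rangle>(x)\<close> that turns the directions of the
  solvability hypothesis into Newton directions. A graph normal \<open>(v, -z)\<close> close to \<open>(u, -d)\<close>
  is a regular subgradient of \<open>\<langle>z, F\<rangle>\<close>. Since \<open>\<langle>z - d, F\<rangle>\<close> has a small Lipschitz
  constant, \<open>v\<close> is an approximate subgradient of \<open>\<langle>d, F\<rangle>\<close>, which is then replaced by an exact one nearby.\<close>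

lemma coderivative_subset_subdifferential_scalarization:
  fixes F :: "'a::euclidean_space \<Rightarrow> 'b::real_inner"
  assumes G: "\<And>y. y \<in> U \<Longrightarrow> G y = {F y}" and U: "open U" "x \<in> U" and L: "L-lipschitz_on U F"
    and u: "u \<in> coderivative G (x, F x) d"
  shows "u \<in> limiting_subdifferential (\<lambda>y. inner d (F y)) x"
  unfolding limiting_subdifferential_iff_nearby[OF inner_lipschitz[OF L] U]
proof (intro allI impI)
  fix \<eta> :: real assume \<eta>: "\<eta> > 0"
  \<comment> \<open>The exact subgradient will be within \<open>4 c = \<eta> / 4\<close> of a vector within \<open>\<eta> / 2\<close> of \<open>u\<close>.\<close>
  define c where "c = \<eta> / 16"
  have c: "c > 0" using \<eta> by (simp add: c_def)
  have L0: "L \<ge> 0" using L by (rule lipschitz_on_nonneg)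
  obtain zs vs where zs: "zs \<longlonglongrightarrow> (x, F x)" and vs: "vs \<longlonglongrightarrow> (u, - d)" and zsG: "\<And>k. zs k \<in> gph G"
    and N: "\<And>k. vs k \<in> regular_normal_cone (gph G) (zs k)"
    using u unfolding coderivative_def limiting_normal_cone_def by blast
  have xs: "(\<lambda>k. fst (zs k)) \<longlonglongrightarrow> x" and us: "(\<lambda>k. fst (vs k)) \<longlonglongrightarrow> u" and ds: "(\<lambda>k. - snd (vs k)) \<longlonglongrightarrow> d"
    using tendsto_fst[OF zs] tendsto_fst[OF vs] tendsto_minus[OF tendsto_snd[OF vs]] by auto
  have "c / (2 * (L + 1)) > 0"
    using c L0 by simp
  from tendstoD[OF ds this] tendstoD[OF us, of "\<eta> / 2"] tendstoD[OF xs, of "\<eta> / 2"]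
    topological_tendstoD[OF xs U] \<eta>
  have "\<forall>\<^sub>F k in sequentially. dist (- snd (vs k)) d < c / (2 * (L + 1)) \<and> dist (fst (vs k)) u < \<eta> / 2
      \<and> dist (fst (zs k)) x < \<eta> / 2 \<and> fst (zs k) \<in> U"
    by (intro eventually_conj) auto
  then obtain k where "dist (- snd (vs k)) d < c / (2 * (L + 1)) \<and> dist (fst (vs k)) u < \<eta> / 2
      \<and> dist (fst (zs k)) x < \<eta> / 2 \<and> fst (zs k) \<in> U"
    using eventually_happens'[OF sequentially_bot] by blast
  moreover define y v z where "y = fst (zs k)" and "v = fst (vs k)" and "z = - snd (vs k)"
  ultimately have z: "norm (z - d) < c / (2 * (L + 1))" and v: "dist v u < \<eta> / 2"
    and y: "dist y x < \<eta> / 2" "y \<in> U"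
    by (auto simp: dist_norm)
  have "zs k = (y, F y)"
    using zsG[of k] y(2) by (cases "zs k") (auto simp: y_def gph_def G)
  then have "v \<in> regular_subdifferential (\<lambda>y. inner z (F y)) y"
    using N[of k] regular_normal_graph_iff[OF G U(1) y(2) L, of v z] by (simp add: v_def z_def)
  then have "\<forall>\<^sub>F w in nhds y. inner z (F y) + inner v (w - y) - c / 2 * norm (w - y) \<le> inner z (F w)"
    unfolding regular_subdifferential_def using c by (auto dest: spec[of _ "c / 2"])
  moreover have "\<forall>\<^sub>F w in nhds y. w \<in> U"
    using U(1) y(2) by (intro eventually_nhds_in_open)
  ultimately have "\<forall>\<^sub>F w in nhds y. w \<in> U \<and> inner d (F y) + inner v (w - y) - c * norm (w - y) \<le> inner d (F w)"
  proof eventually_elim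
    case (elim w)
    have "\<bar>inner (z - d) (F w) - inner (z - d) (F y)\<bar> \<le> norm (z - d) * L * norm (w - y)"
      using lipschitz_onD[OF inner_lipschitz[OF L, of "z - d"] elim(2) y(2)]
      by (simp add: dist_real_def dist_norm)
    also have "\<dots> \<le> c / 2 * norm (w - y)"
    proof (intro mult_right_mono)
      have "norm (z - d) * (L + 1) \<le> c / 2"
        using z L0 by (simp add: pos_less_divide_eq algebra_simps)
      moreover have "norm (z - d) * L \<le> norm (z - d) * (L + 1)"
        by (intro mult_left_mono) auto
      ultimately show "norm (z - d) * L \<le> c / 2" by simp
    qed simp
    finally have "inner (z - d) (F w) - inner (z - d) (F y) \<le> c / 2 * norm (w - y)"
      by (rule order_trans[OF abs_ge_self])
    then show ?case
      using elim by (simp add: inner_diff_left)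
  qed
  then obtain r0 where r0: "r0 > 0" "\<And>w. dist w y < r0 \<Longrightarrow>
      w \<in> U \<and> inner d (F y) + inner v (w - y) - c * norm (w - y) \<le> inner d (F w)"
    unfolding eventually_nhds_metric by blast
  define r where "r = min (r0 / 2) (\<eta> / 2)"
  have r: "r > 0" "r < r0" "r \<le> \<eta> / 2"
    using r0 \<eta> by (auto simp: r_def)
  have inr: "dist w y < r0" if "w \<in> cball y r" for w
    using that r by (simp add: dist_commute)
  have "continuous_on (cball y r) (\<lambda>w. inner d (F w))"
    by (intro continuous_intros continuous_on_subset[OF lipschitz_on_continuous_on[OF L]])
      (use r0 inr in blast)
  from regular_subgradient_near_approximate[OF this r(1) c] r0(2)[OF inr]
  obtain x' u' where "dist y x' < r" "u' \<in> regular_subdifferential (\<lambda>w. inner d (F w)) x'" "norm (u' - v) \<le> 4 * c"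
    by blast
  moreover from this have "dist x' x < \<eta>"
    using y(1) r(3) dist_triangle[of x' x y] by (simp add: dist_commute)
  moreover have "dist u' u < \<eta>"
    using v \<open>norm (u' - v) \<le> 4 * c\<close> dist_triangle[of u' u v] \<eta> by (simp add: c_def dist_norm)
  ultimately show "\<exists>x' u'. dist x' x < \<eta> \<and> dist u' u < \<eta> \<and>
      u' \<in> regular_subdifferential (\<lambda>y. inner d (F y)) x'"
    by blast
qed

section \<open>Semismoothness and generalized second derivatives\<close>

text \<open>A violating sequence, rescaled by \<open>t = \<parallel>x - xbar\<parallel>\<close>, is bounded: the difference quotients and the
  subgradients by the Lipschitz constant, the multipliers \<open>z\<close> by normalization. A cluster point is
  a directional normal that contradicts the defining equation of semismoothness\<open>\<^sup>*\<close>.\<close>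

lemma semismooth_star_uniform_estimate:
  fixes F :: "'a::euclidean_space \<Rightarrow> 'b::euclidean_space"
  assumes G: "\<And>y. y \<in> U \<Longrightarrow> G y = {F y}" and U: "open U" "xbar \<in> U" and L: "L-lipschitz_on U F"
    and ss: "semismooth_star G xbar (F xbar)" and e: "e > 0"
  obtains \<delta> where "\<delta> > 0" "ball xbar \<delta> \<subseteq> U"
    "\<And>x z u. x \<in> ball xbar \<delta> \<Longrightarrow> norm z = 1 \<Longrightarrow> u \<in> regular_subdifferential (\<lambda>y. inner z (F y)) x \<Longrightarrow>
       \<bar>inner u (x - xbar) - inner z (F x - F xbar)\<bar> \<le> e * norm (x - xbar)"
proof -
  obtain \<delta>0 where \<delta>0: "\<delta>0 > 0" "ball xbar \<delta>0 \<subseteq> U"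
    using U by (meson open_contains_ball)
  let ?good = "\<lambda>x z u. \<bar>inner u (x - xbar) - inner z (F x - F xbar)\<bar> \<le> e * norm (x - xbar)"
  have "\<exists>\<delta>>0. \<delta> \<le> \<delta>0 \<and> (\<forall>x z u. x \<in> ball xbar \<delta> \<longrightarrow> norm z = 1 \<longrightarrow>
      u \<in> regular_subdifferential (\<lambda>y. inner z (F y)) x \<longrightarrow> ?good x z u)"
  proof (rule ccontr)
    assume "\<not> ?thesis"
    then have neg: "\<exists>x z u. x \<in> ball xbar \<delta> \<and> norm z = 1 \<and>
        u \<in> regular_subdifferential (\<lambda>y. inner z (F y)) x \<and> \<not> ?good x z u" if "\<delta> > 0" "\<delta> \<le> \<delta>0" for \<delta>
      using that by blast
    have "\<exists>x z u. x \<in> ball xbar (\<delta>0 * inverse (real (Suc k))) \<and> norm z = 1 \<and>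
        u \<in> regular_subdifferential (\<lambda>y. inner z (F y)) x \<and> \<not> ?good x z u" for k
      by (rule neg) (use \<delta>0(1) in \<open>auto simp: divide_simps\<close>)
    then obtain x z u where x: "\<And>k. x k \<in> ball xbar (\<delta>0 * inverse (real (Suc k)))"
      and z: "\<And>k. norm (z k) = 1"
      and u: "\<And>k. u k \<in> regular_subdifferential (\<lambda>y. inner (z k) (F y)) (x k)"
      and bad: "\<And>k::nat. \<not> ?good (x k) (z k) (u k)"
      by metis
    have xU: "x k \<in> U" for k
    proof -
      have "\<delta>0 * inverse (real (Suc k)) \<le> \<delta>0"
        using \<delta>0(1) by (auto simp: divide_simps)
      then show ?thesis
        using x[of k] \<delta>0(2) by (auto simp: subset_iff)
    qed
    have L0: "L \<ge> 0" using L by (rule lipschitz_on_nonneg)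
    define t where "t k = norm (x k - xbar)" for k
    have t: "t k > 0" for k
      using bad[of k] by (cases "x k = xbar") (auto simp: t_def)
    define p where "p k = (x k - xbar) /\<^sub>R t k" for k
    define q where "q k = (F (x k) - F xbar) /\<^sub>R t k" for k
    have np: "norm (p k) \<le> 1" for k
      using t[of k] by (simp add: p_def t_def)
    have nq: "norm (q k) \<le> L" for k
      using lipschitz_onD[OF L xU[of k] U(2)] t[of k]
      by (simp add: q_def t_def dist_norm divide_simps mult.commute)
    have nu: "norm (u k) \<le> L" for k
      using norm_regular_subgradient_le[OF inner_lipschitz[OF L] U(1) xU u] z by simp
    define W where "W k = ((p k, q k), (u k, z k))" for k
    have "norm (W k) \<le> (1 + L) + (L + 1)" for k
      unfolding W_def using np[of k] nq[of k] nu[of k] z[of k]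
      by (smt (verit) norm_Pair_le)
    then have "bounded (range W)"
      by (auto simp: bounded_iff)
    then obtain l r where r: "strict_mono r" and l: "(W \<circ> r) \<longlonglongrightarrow> l"
      using bounded_imp_convergent_subsequence by blast
    obtain a b u' z' where lab: "l = ((a, b), (u', z'))"
      by (metis surj_pair)
    have pl: "(\<lambda>k. p (r k)) \<longlonglongrightarrow> a" and ql: "(\<lambda>k. q (r k)) \<longlonglongrightarrow> b"
      and ul: "(\<lambda>k. u (r k)) \<longlonglongrightarrow> u'" and zl: "(\<lambda>k. z (r k)) \<longlonglongrightarrow> z'"
      using tendsto_fst[OF tendsto_fst[OF l]] tendsto_snd[OF tendsto_fst[OF l]]
        tendsto_fst[OF tendsto_snd[OF l]] tendsto_snd[OF tendsto_snd[OF l]]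
      by (simp_all add: lab W_def comp_def)
    have "(\<lambda>k. \<delta>0 * inverse (real (Suc k))) \<longlonglongrightarrow> \<delta>0 * 0"
      by (intro tendsto_intros LIMSEQ_inverse_real_of_nat)
    then have "(\<lambda>k. \<delta>0 * inverse (real (Suc k))) \<longlonglongrightarrow> 0"
      by simp
    then have "t \<longlonglongrightarrow> 0"
    proof (rule Lim_null_comparison[rotated])
      show "\<forall>\<^sub>F k in sequentially. norm (t k) \<le> \<delta>0 * inverse (real (Suc k))"
        using x by (intro always_eventually) (auto simp: t_def dist_norm norm_minus_commute less_imp_le)
    qed
    then have tl: "(\<lambda>k. t (r k)) \<longlonglongrightarrow> 0"
      using LIMSEQ_subseq_LIMSEQ[OF _ r] by (simp add: comp_def)
    have "(u (r k), - z (r k)) \<in> regular_normal_cone (gph G) ((xbar, F xbar) + t (r k) *\<^sub>R (p (r k), q (r k)))" for k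
    proof -
      have "(xbar, F xbar) + t (r k) *\<^sub>R (p (r k), q (r k)) = (x (r k), F (x (r k)))"
        using t[of "r k"] by (simp add: p_def q_def)
      then show ?thesis
        using u[of "r k"] regular_normal_graph_iff[OF G U(1) xU L] by simp
    qed
    moreover have "(\<lambda>k. (p (r k), q (r k))) \<longlonglongrightarrow> (a, b)" "(\<lambda>k. (u (r k), - z (r k))) \<longlonglongrightarrow> (u', - z')"
      by (intro tendsto_Pair tendsto_minus pl ql ul zl)+
    ultimately have "(u', - z') \<in> directional_normal_cone (gph G) (xbar, F xbar) (a, b)"
      unfolding directional_normal_cone_def mem_Collect_eq using tl t
      by (intro exI[of _ "\<lambda>k. t (r k)"] exI[of _ "\<lambda>k. (p (r k), q (r k))"] exI[of _ "\<lambda>k. (u (r k), - z (r k))"]) auto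
    then have "inner u' a = inner z' b"
      using ss by (simp add: semismooth_star_def directional_coderivative_def)
    moreover have "(\<lambda>k. \<bar>inner (u (r k)) (p (r k)) - inner (z (r k)) (q (r k))\<bar>) \<longlonglongrightarrow> \<bar>inner u' a - inner z' b\<bar>"
      by (intro tendsto_intros pl ql ul zl)
    moreover have "e \<le> \<bar>inner (u (r k)) (p (r k)) - inner (z (r k)) (q (r k))\<bar>" for k
    proof -
      have "inner (u (r k)) (p (r k)) - inner (z (r k)) (q (r k))
          = (inner (u (r k)) (x (r k) - xbar) - inner (z (r k)) (F (x (r k)) - F xbar)) / t (r k)"
        by (simp add: p_def q_def divide_inverse_commute right_diff_distrib)
      then show ?thesis
        using bad[of "r k"] t[of "r k"] by (simp add: t_def pos_le_divide_eq)
    qed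
    ultimately show False
      using e LIMSEQ_le_const[of "\<lambda>k. \<bar>inner (u (r k)) (p (r k)) - inner (z (r k)) (q (r k))\<bar>" 0 e] by auto
  qed
  then obtain \<delta> where "\<delta> > 0" "\<delta> \<le> \<delta>0" "\<And>x z u. x \<in> ball xbar \<delta> \<Longrightarrow> norm z = 1 \<Longrightarrow>
      u \<in> regular_subdifferential (\<lambda>y. inner z (F y)) x \<Longrightarrow> ?good x z u"
    by blast
  then show ?thesis
    using that[of \<delta>] \<delta>0(2) by (meson subset_ball subset_trans)
qed

text \<open>Near \<open>x\<close> every regular subgradient of \<open>\<langle>z, F\<rangle>\<close> has slope about \<open>\<langle>z, F x - F xbar\<rangle>\<close> along
  \<open>x - xbar\<close>: the estimate at nearby points \<open>w\<close> carries over because \<open>R\<close> is small compared with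
  \<open>\<parallel>x - xbar\<parallel>\<close>. The mean value inequality turns this into increments of \<open>F\<close>, one
  unit vector \<open>z\<close> at a time.\<close>

lemma increments_along_ray:
  fixes F :: "'a::euclidean_space \<Rightarrow> 'b::euclidean_space"
  assumes L: "L-lipschitz_on (ball xbar \<delta>) F" and e: "e > 0"
    and est: "\<And>x z u. x \<in> ball xbar \<delta> \<Longrightarrow> norm z = 1 \<Longrightarrow>
       u \<in> regular_subdifferential (\<lambda>y. inner z (F y)) x \<Longrightarrow>
       \<bar>inner u (x - xbar) - inner z (F x - F xbar)\<bar> \<le> e * norm (x - xbar)"
    and x: "x \<in> ball xbar \<delta>" "x \<noteq> xbar"
  obtains R where "R > 0" "ball x R \<subseteq> ball xbar \<delta>"
    "\<And>a t. t > 0 \<Longrightarrow> a \<in> ball x R \<Longrightarrow> a + t *\<^sub>R (x - xbar) \<in> ball x R \<Longrightarrow>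
       norm (F (a + t *\<^sub>R (x - xbar)) - F a - t *\<^sub>R (F x - F xbar)) \<le> t * (2 * e * norm (x - xbar))"
proof -
  have L0: "L \<ge> 0" using L by (rule lipschitz_on_nonneg)
  define h where "h = x - xbar"
  \<comment> \<open>The second bound makes the errors from moving \<open>F\<close>, \<open>u\<close> and the base point by \<open>R\<close>,
    in total \<open>R (2 L + e)\<close>, at most \<open>e \<parallel>h\<parallel>\<close>.\<close>
  define R where "R = min (\<delta> - dist xbar x) (e * norm h / (2 * L + e))"
  have R: "R > 0"
    using x e L0 by (auto simp: R_def h_def intro!: divide_pos_pos)
  have "R \<le> e * norm h / (2 * L + e)"
    by (simp add: R_def)
  then have Re: "R * (2 * L + e) \<le> e * norm h"
    using e L0 by (simp add: pos_le_divide_eq)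
  have sub: "ball x R \<subseteq> ball xbar \<delta>"
  proof
    fix y assume "y \<in> ball x R"
    then show "y \<in> ball xbar \<delta>"
      using dist_triangle[of xbar y x] by (simp add: R_def)
  qed
  have slope: "inner u h \<le> inner z (F x - F xbar) + 2 * e * norm h"
    if w: "w \<in> ball x R" and z: "norm z = 1" and u: "u \<in> regular_subdifferential (\<lambda>y. inner z (F y)) w" for w z u
  proof -
    have wx: "norm (x - w) \<le> R"
      using w by (simp add: dist_norm)
    have wb: "w \<in> ball xbar \<delta>"
      using w sub by blast
    have "norm u \<le> L"
      using norm_regular_subgradient_le[OF inner_lipschitz[OF L] open_ball wb u] z by simp
    then have 1: "inner u (x - w) \<le> L * R"
      using wx L0 norm_cauchy_schwarz[of u "x - w"] mult_mono[of "norm u" L "norm (x - w)" R] by simp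
    have "norm (F w - F x) \<le> L * R"
      using lipschitz_onD[OF L wb x(1)] wx L0 mult_left_mono[OF wx L0]
      by (simp add: dist_norm norm_minus_commute)
    then have 2: "inner z (F w - F x) \<le> L * R"
      using norm_cauchy_schwarz[of z "F w - F x"] z by simp
    have "norm (w - xbar) \<le> norm h + R"
      using norm_triangle_ineq[of h "w - x"] wx by (simp add: h_def norm_minus_commute)
    then have "e * norm (w - xbar) \<le> e * (norm h + R)"
      using e by simp
    then have 3: "inner u (w - xbar) \<le> inner z (F w - F xbar) + e * (norm h + R)"
      using est[OF wb z u] by (simp add: abs_le_iff)
    have "inner u h = inner u (w - xbar) + inner u (x - w)"
      by (simp add: h_def inner_diff_right)
    also have "\<dots> \<le> inner z (F w - F xbar) + e * (norm h + R) + L * R"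
      using 1 3 by simp
    also have "\<dots> \<le> inner z (F x - F xbar) + L * R + e * (norm h + R) + L * R"
      using 2 by (simp add: inner_diff_right)
    also have "\<dots> \<le> inner z (F x - F xbar) + 2 * e * norm h"
      using Re by (simp add: algebra_simps)
    finally show ?thesis .
  qed
  have "norm (F (a + t *\<^sub>R h) - F a - t *\<^sub>R (F x - F xbar)) \<le> t * (2 * e * norm h)"
    if t: "t > 0" and a: "a \<in> ball x R" and b: "a + t *\<^sub>R h \<in> ball x R" for a t
  proof -
    define D where "D = F (a + t *\<^sub>R h) - F a - t *\<^sub>R (F x - F xbar)"
    show ?thesis
    proof (cases "D = 0")
      case True
      then show ?thesis
        using t e unfolding D_def by simp
    next
      case False
      define z where "z = sgn D"
      have z: "norm z = 1"
        using False by (simp add: z_def norm_sgn)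
      have "inner z (F (a + t *\<^sub>R h)) - inner z (F a) \<le> t * (inner z (F x - F xbar) + 2 * e * norm h)"
      proof (rule mean_value_regular_subgradients[OF _ a b])
        show "continuous_on (ball x R) (\<lambda>y. inner z (F y))"
          by (intro continuous_intros continuous_on_subset[OF lipschitz_on_continuous_on[OF L] sub])
        show "inner u (t *\<^sub>R h) \<le> t * (inner z (F x - F xbar) + 2 * e * norm h)"
          if "w \<in> ball x R" "u \<in> regular_subdifferential (\<lambda>y. inner z (F y)) w" for w u
          using slope[OF that(1) z that(2)] t by simp
      qed
      then have "inner z D \<le> t * (2 * e * norm h)"
        by (simp add: D_def inner_diff_right algebra_simps)
      moreover have "inner z D = norm D"
        using False by (simp add: z_def sgn_div_norm power2_norm_eq_inner[symmetric] power2_eq_square)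
      ultimately show ?thesis
        by (simp add: D_def)
    qed
  qed
  then show ?thesis
    using that[OF R sub] by (simp add: h_def)
qed

text \<open>This is where the symmetry of second derivatives enters. The increment of \<open>F\<close> along \<open>h\<close> is the
  gradient of \<open>y \<mapsto> \<phi> (y + t h) - \<phi> y\<close>, so a bound on the increment is a Lipschitz bound on this
  function up to the linear term \<open>t \<langle>p, y\<rangle>\<close>. After division by \<open>t\<close>, the limit \<open>t \<rightarrow> 0\<close> replaces the difference
  quotient by \<open>\<langle>h, F y\<rangle>\<close>. Information on how \<open>F\<close> changes along \<open>h\<close> has become information on how the
  component of \<open>F\<close> along \<open>h\<close> changes in all directions.\<close>

lemma lipschitz_directional_derivative:
  fixes \<phi> :: "'a::euclidean_space \<Rightarrow> real"
  assumes der: "\<And>y. y \<in> ball x R \<Longrightarrow> GDERIV \<phi> y :> F y" and C: "C \<ge> 0"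
    and incr: "\<And>a t. t > 0 \<Longrightarrow> a \<in> ball x R \<Longrightarrow> a + t *\<^sub>R h \<in> ball x R \<Longrightarrow>
       norm (F (a + t *\<^sub>R h) - F a - t *\<^sub>R p) \<le> t * C"
  shows "C-lipschitz_on (ball x (R / 2)) (\<lambda>y. inner h (F y) - inner p y)"
proof (rule lipschitz_onI[OF _ C])
  fix a b assume a: "a \<in> ball x (R / 2)" and b: "b \<in> ball x (R / 2)"
  then have R: "R > 0"
    by (metis ball_eq_empty empty_iff half_gt_zero_iff linorder_not_le)
  have half: "y \<in> ball x R" if "y \<in> ball x (R / 2)" for y
    using that R by simp
  have shift: "((\<lambda>t. (\<phi> (y + t *\<^sub>R h) - \<phi> y) / t) \<longlongrightarrow> inner h (F y)) (at_right 0)" if "y \<in> ball x R" for y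
  proof -
    have "((\<lambda>t. \<phi> (y + t *\<^sub>R h)) has_derivative (\<lambda>t. inner (t *\<^sub>R h) (F y))) (at 0)"
    proof (rule has_derivative_compose[where f = "\<lambda>t. y + t *\<^sub>R h" and g = \<phi>])
      show "((\<lambda>t. y + t *\<^sub>R h) has_derivative (\<lambda>t. t *\<^sub>R h)) (at 0)"
        by (auto intro!: derivative_eq_intros)
      show "(\<phi> has_derivative (\<lambda>k. inner k (F y))) (at (y + 0 *\<^sub>R h))"
        using der[OF that] by (simp add: gderiv_def)
    qed
    then have "((\<lambda>t. \<phi> (y + t *\<^sub>R h)) has_real_derivative inner h (F y)) (at 0)"
      by (simp add: has_field_derivative_def mult_commute_abs)
    then have "((\<lambda>t. (\<phi> (y + t *\<^sub>R h) - \<phi> y) / t) \<longlongrightarrow> inner h (F y)) (at 0)"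
      by (simp add: DERIV_def)
    then show ?thesis
      by (rule tendsto_mono[OF at_le, rotated]) simp
  qed
  have small: "\<forall>\<^sub>F t in at_right (0::real). t * norm h < R / 2"
  proof -
    have "((\<lambda>t::real. t * norm h) \<longlongrightarrow> 0 * norm h) (at_right 0)"
      by (intro tendsto_intros tendsto_ident_at)
    then show ?thesis
      using R by (intro order_tendstoD(2)) auto
  qed
  moreover have pos: "\<forall>\<^sub>F t in at_right (0::real). t > 0"
    by (simp add: eventually_at_right_less)
  ultimately have "\<forall>\<^sub>F t in at_right 0.
      \<bar>((\<phi> (a + t *\<^sub>R h) - \<phi> a) / t - inner p a) - ((\<phi> (b + t *\<^sub>R h) - \<phi> b) / t - inner p b)\<bar> \<le> C * norm (a - b)"
  proof eventually_elim
    case (elim t)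
    define g where "g y = (\<phi> (y + t *\<^sub>R h) - \<phi> y) - t * inner p y" for y
    have mv: "y + t *\<^sub>R h \<in> ball x R" if "y \<in> ball x (R / 2)" for y
    proof -
      have "dist x (y + t *\<^sub>R h) \<le> dist x y + dist y (y + t *\<^sub>R h)"
        by (rule dist_triangle)
      then show ?thesis
        using that elim by (simp add: dist_norm)
    qed
    have "norm (g a - g b) \<le> (t * C) * norm (a - b)"
    proof (rule differentiable_bound[OF convex_ball _ _ a b])
      fix y assume y: "y \<in> ball x (R / 2)"
      have d1: "((\<lambda>y. \<phi> (y + t *\<^sub>R h)) has_derivative (\<lambda>k. inner k (F (y + t *\<^sub>R h)))) (at y)"
      proof (rule has_derivative_compose[where f = "\<lambda>y. y + t *\<^sub>R h" and g = \<phi>])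
        show "((\<lambda>y. y + t *\<^sub>R h) has_derivative (\<lambda>k. k)) (at y)"
          by (auto intro!: derivative_eq_intros)
        show "(\<phi> has_derivative (\<lambda>k. inner k (F (y + t *\<^sub>R h)))) (at (y + t *\<^sub>R h))"
          using der[OF mv[OF y]] by (simp add: gderiv_def)
      qed
      have d2: "(\<phi> has_derivative (\<lambda>k. inner k (F y))) (at y)"
        using der[OF half[OF y]] by (simp add: gderiv_def)
      have "(g has_derivative (\<lambda>k. (inner k (F (y + t *\<^sub>R h)) - inner k (F y)) - t * inner p k)) (at y)"
        unfolding g_def by (intro has_derivative_diff d1 d2 has_derivative_mult_right has_derivative_inner_right has_derivative_ident)
      then have "(g has_derivative (\<lambda>k. inner k (F (y + t *\<^sub>R h) - F y - t *\<^sub>R p))) (at y)"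
        by (simp add: inner_diff_right inner_commute)
      then show "(g has_derivative (\<lambda>k. inner k (F (y + t *\<^sub>R h) - F y - t *\<^sub>R p))) (at y within ball x (R / 2))"
        by (rule has_derivative_at_withinI)
      show "onorm (\<lambda>k. inner k (F (y + t *\<^sub>R h) - F y - t *\<^sub>R p)) \<le> t * C"
      proof (rule onorm_le)
        fix k
        have "norm (inner k (F (y + t *\<^sub>R h) - F y - t *\<^sub>R p)) \<le> norm k * norm (F (y + t *\<^sub>R h) - F y - t *\<^sub>R p)"
          by (simp add: Cauchy_Schwarz_ineq2)
        also have "\<dots> \<le> norm k * (t * C)"
          using incr[OF elim(2) half[OF y] mv[OF y]] by (intro mult_left_mono) auto
        finally show "norm (inner k (F (y + t *\<^sub>R h) - F y - t *\<^sub>R p)) \<le> t * C * norm k"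
          by (simp add: mult.commute)
      qed
    qed
    then have "\<bar>g a - g b\<bar> / t \<le> C * norm (a - b)"
      using elim by (simp add: pos_divide_le_eq mult.commute mult.left_commute)
    moreover have "((\<phi> (a + t *\<^sub>R h) - \<phi> a) / t - inner p a) - ((\<phi> (b + t *\<^sub>R h) - \<phi> b) / t - inner p b) = (g a - g b) / t"
      using elim by (simp add: g_def diff_divide_distrib)
    ultimately show ?case
      using elim by (simp add: abs_divide)
  qed
  then have "\<bar>(inner h (F a) - inner p a) - (inner h (F b) - inner p b)\<bar> \<le> C * norm (a - b)"
    by (intro tendsto_upperbound[OF tendsto_rabs[OF tendsto_diff[OF tendsto_diff[OF shift[OF half[OF a]] tendsto_const]
          tendsto_diff[OF shift[OF half[OF b]] tendsto_const]]]]) auto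
  then show "dist (inner h (F a) - inner p a) (inner h (F b) - inner p b) \<le> C * dist a b"
    by (simp add: dist_norm)
qed

section \<open>Metric regularity and the Newton step\<close>

text \<open>The only consequence of metric regularity used below: the values of \<open>F\<close> near \<open>xbar\<close> can be
  perturbed slightly in every direction, with linear control of the preimage. The constant doubles because the
  distance to \<open>G\<^sup>-\<^sup>1(y)\<close> need not be attained.\<close>

lemma metric_regularity_local_solvability:
  fixes F :: "'a::metric_space \<Rightarrow> 'b::metric_space"
  assumes mr: "metrically_regular G xbar (F xbar)"
    and G: "\<And>y. y \<in> U \<Longrightarrow> G y = {F y}" and U: "open U" "xbar \<in> U" and cont: "continuous_on U F"
  obtains \<mu> W where "\<mu> > 0" "open W" "xbar \<in> W" "W \<subseteq> U"
    "\<And>x. x \<in> W \<Longrightarrow> \<forall>\<^sub>F y in nhds (F x). \<exists>x'. y \<in> G x' \<and> dist x x' \<le> \<mu> * dist y (F x)"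
proof -
  obtain \<mu> A V where \<mu>: "\<mu> > 0" and A: "open A" "xbar \<in> A" and V: "open V" "F xbar \<in> V"
    and reg: "\<And>x y. x \<in> A \<Longrightarrow> y \<in> V \<Longrightarrow>
      set_distance x {x'. y \<in> G x'} \<le> ereal \<mu> * set_distance y (G x)"
    using mr unfolding metrically_regular_def by blast
  define W where "W = A \<inter> (U \<inter> F -` V)"
  have W: "open W" "xbar \<in> W" "W \<subseteq> U"
    using A U V continuous_open_preimage[OF cont U(1) V(1)] by (auto simp: W_def)
  have "\<forall>\<^sub>F y in nhds (F x). \<exists>x'. y \<in> G x' \<and> dist x x' \<le> 2 * \<mu> * dist y (F x)" if "x \<in> W" for x
  proof -
    have "\<forall>\<^sub>F y in nhds (F x). y \<in> V"
      using that V by (intro eventually_nhds_in_open) (auto simp: W_def)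
    then show ?thesis
    proof eventually_elim
      case (elim y)
      show ?case
      proof (cases "y = F x")
        case True
        then show ?thesis
          using that W(3) G by (intro exI[of _ x]) auto
      next
        case False
        have "set_distance x {x'. y \<in> G x'} \<le> ereal \<mu> * set_distance y (G x)"
          using that elim by (intro reg) (auto simp: W_def)
        also have "\<dots> = ereal (\<mu> * dist y (F x))"
          using that W(3) G[of x] by (auto simp: set_distance_def)
        also have "\<dots> < ereal (2 * \<mu> * dist y (F x))"
          using \<mu> False by simp
        finally obtain x' where "y \<in> G x'" "ereal (dist x x') < ereal (2 * \<mu> * dist y (F x))"
          unfolding set_distance_def by (auto simp: INF_less_iff)
        then show ?thesis
          by (intro exI[of _ x']) auto
      qed
    qed
  qed
  then show ?thesis
    using that[of "2 * \<mu>" W] \<mu> W by simp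
qed

text \<open>In the application \<open>h = x - xbar\<close> and \<open>p = F x\<close>, and \<open>z = h + d\<close> is the error after the step. At points
  near \<open>x\<close>, \<open>\<langle>d, F\<rangle>\<close> decreases at most like \<open>-\<langle>p, \<cdot>\<rangle>\<close>, and \<open>\<langle>h, F\<rangle>\<close> is \<open>\<langle>p, \<cdot>\<rangle>\<close> up to
  Lipschitz constant \<open>C\<close>. The linear terms cancel, so \<open>\<langle>z, F\<rangle>\<close> decreases at a rate of at most about \<open>C\<close>.
  Solving \<open>F y = F x' - s z\<close> lowers \<open>\<langle>z, F\<rangle>\<close> by \<open>s \<parallel>z\<parallel>\<^sup>2\<close> at the price of a displacement
  of at most \<open>\<mu> s \<parallel>z\<parallel>\<close>, hence at a rate of at least \<open>\<parallel>z\<parallel> / \<mu>\<close>.\<close>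

lemma newton_step_bound:
  fixes F :: "'a::euclidean_space \<Rightarrow> 'a"
  assumes G: "\<And>y. y \<in> W \<Longrightarrow> G y = {F y}" and W: "open W" "x \<in> W" and L: "L-lipschitz_on W F"
    and \<mu>: "\<mu> > 0"
    and solv: "\<And>x. x \<in> W \<Longrightarrow> \<forall>\<^sub>F y in nhds (F x). \<exists>x'. y \<in> G x' \<and> dist x x' \<le> \<mu> * dist y (F x)"
    and R: "R > 0" and C: "C-lipschitz_on (ball x R) (\<lambda>y. inner h (F y) - inner p y)"
    and d: "- p \<in> limiting_subdifferential (\<lambda>y. inner d (F y)) x"
  shows "norm (h + d) \<le> \<mu> * C"
proof (cases "h + d = 0")
  case True
  then show ?thesis
    using \<mu> lipschitz_on_nonneg[OF C] by simp
next
  case False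
  define z where "z = h + d"
  have z: "norm z > 0"
    using False by (simp add: z_def)
  have "norm z \<le> \<mu> * C + \<epsilon>" if "\<epsilon> > 0" for \<epsilon>
  proof -
    define \<eta> where "\<eta> = \<epsilon> / \<mu>"
    have \<eta>: "\<eta> > 0" "\<mu> * \<eta> = \<epsilon>"
      using that \<mu> by (auto simp: \<eta>_def)
    obtain \<rho> where \<rho>: "\<rho> > 0" "ball x \<rho> \<subseteq> W \<inter> ball x R"
      using W R by (metis open_Int open_ball open_contains_ball IntI centre_in_ball)
    obtain x' u where x': "dist x' x < min \<rho> (\<eta> / 2)" and ud: "dist u (- p) < min \<rho> (\<eta> / 2)"
      and u: "u \<in> regular_subdifferential (\<lambda>y. inner d (F y)) x'"
      using d \<rho>(1) \<eta>(1) unfolding limiting_subdifferential_iff_nearby[OF inner_lipschitz[OF L] W]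
      by (metis half_gt_zero min_less_iff_conj)
    have in': "x' \<in> W \<inter> ball x R"
      using \<rho>(2) x' by (auto simp: dist_commute subset_iff)
    have up: "norm (u + p) \<le> \<eta> / 2"
      using ud by (simp add: dist_norm)
    have "\<forall>\<^sub>F y in nhds x'. inner d (F x') + inner u (y - x') - \<eta> / 2 * norm (y - x') \<le> inner d (F y)"
      using u \<eta>(1) unfolding regular_subdifferential_def by (auto dest: spec[of _ "\<eta> / 2"])
    moreover have "\<forall>\<^sub>F y in nhds x'. y \<in> W \<inter> ball x R"
      using in' W by (intro eventually_nhds_in_open) auto
    ultimately have "\<forall>\<^sub>F y in nhds x'. y \<in> W \<and> inner z (F x') - (C + \<eta>) * norm (y - x') \<le> inner z (F y)"
    proof eventually_elim
      case (elim y)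
      have "\<bar>(inner h (F y) - inner p y) - (inner h (F x') - inner p x')\<bar> \<le> C * norm (y - x')"
        using lipschitz_onD[OF C, of y x'] elim in' by (simp add: dist_norm)
      then have "inner h (F x') + inner p (y - x') - C * norm (y - x') \<le> inner h (F y)"
        by (simp add: abs_le_iff inner_diff_right)
      moreover have "- (\<eta> / 2 * norm (y - x')) \<le> inner (u + p) (y - x')"
        using Cauchy_Schwarz_ineq2[of "u + p" "y - x'"] mult_right_mono[OF up norm_ge_zero[of "y - x'"]]
        by linarith
      ultimately show ?case
        using elim by (simp add: z_def inner_add_left algebra_simps)
    qed
    then obtain r where r: "r > 0" "\<And>y. dist y x' < r \<Longrightarrow>
        y \<in> W \<and> inner z (F x') - (C + \<eta>) * norm (y - x') \<le> inner z (F y)"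
      unfolding eventually_nhds_metric by blast
    have "\<forall>\<^sub>F s in at_right (0::real). \<exists>y. F x' + s *\<^sub>R (- z) \<in> G y \<and> dist x' y \<le> \<mu> * dist (F x' + s *\<^sub>R (- z)) (F x')"
      using in' by (intro eventually_along_ray solv) auto
    moreover have "\<forall>\<^sub>F s in at_right (0::real). \<mu> * (s * norm z) < r"
    proof -
      have "((\<lambda>s::real. \<mu> * (s * norm z)) \<longlongrightarrow> \<mu> * (0 * norm z)) (at_right 0)"
        by (intro tendsto_intros tendsto_ident_at)
      then show ?thesis
        using r by (intro order_tendstoD(2)) auto
    qed
    moreover have "\<forall>\<^sub>F s in at_right (0::real). s > 0"
      by (simp add: eventually_at_right_less)
    ultimately have "\<forall>\<^sub>F s in at_right (0::real). norm z \<le> \<mu> * C + \<epsilon>"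
    proof eventually_elim
      case (elim s)
      then obtain y where y: "F x' + s *\<^sub>R (- z) \<in> G y" "dist x' y \<le> \<mu> * (s * norm z)"
        by (auto simp: dist_norm)
      then have "dist y x' < r"
        using elim by (simp add: dist_commute)
      from r(2)[OF this] have yW: "y \<in> W" and le: "inner z (F x') - (C + \<eta>) * norm (y - x') \<le> inner z (F y)"
        by auto
      have Fy: "F y = F x' - s *\<^sub>R z"
        using y(1) G[OF yW] by simp
      have "s * (norm z * norm z) \<le> (C + \<eta>) * norm (y - x')"
        using le by (simp add: Fy inner_diff_right power2_norm_eq_inner[symmetric] power2_eq_square)
      also have "\<dots> \<le> (C + \<eta>) * (\<mu> * (s * norm z))"
        using y(2) \<eta> lipschitz_on_nonneg[OF C]
        by (intro mult_left_mono) (auto simp: dist_norm norm_minus_commute)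
      finally have "(s * norm z) * norm z \<le> (s * norm z) * (\<mu> * C + \<epsilon>)"
        unfolding \<eta>(2)[symmetric] by (simp add: algebra_simps)
      then show ?case
        using elim z by (simp add: mult_le_cancel_left)
    qed
    then show ?thesis
      by simp
  qed
  then show ?thesis
    unfolding z_def by (rule field_le_epsilon)
qed

section \<open>Superlinear convergence\<close>

lemma GDERIV_unique:
  assumes "GDERIV f x :> g" "GDERIV f x :> g'"
  shows "g = g'"
proof -
  have "(\<lambda>h. inner h g) = (\<lambda>h. inner h g')"
    using assms unfolding gderiv_def by (rule has_derivative_unique)
  then show ?thesis
    by (metis vector_eq_ldot)
qed

lemma GDERIV_gradient:
  fixes \<phi> :: "'a::euclidean_space \<Rightarrow> real"
  assumes "\<phi> differentiable (at x)"
  shows "GDERIV \<phi> x :> gradient \<phi> x"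
proof -
  obtain f' where f': "(\<phi> has_derivative f') (at x)"
    using assms by (auto simp: differentiable_def)
  then have "linear f'"
    by (rule has_derivative_linear)
  then have "f' = (\<lambda>h. inner h (adjoint f' 1))"
    by (auto simp: adjoint_works)
  then have "GDERIV \<phi> x :> adjoint f' 1"
    using f' by (simp add: gderiv_def)
  then show ?thesis
    unfolding gradient_def by (rule theI) (metis GDERIV_unique \<open>GDERIV \<phi> x :> adjoint f' 1\<close>)
qed

lemma gradient_map_eq:
  fixes \<phi> :: "'a::euclidean_space \<Rightarrow> real"
  assumes "\<phi> differentiable (at x)"
  shows "gradient_map \<phi> x = {gradient \<phi> x}"
  using GDERIV_gradient[OF assms] GDERIV_unique by (auto simp: gradient_map_def)

text \<open>Since \<open>\<epsilon>\<close> is arbitrary, this is the one-step form of superlinear convergence, uniform in the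
  choice of the direction.\<close>

lemma newton_contraction:
  fixes \<phi> :: "'a::euclidean_space \<Rightarrow> real"
  assumes diff: "\<And>y. y \<in> U \<Longrightarrow> \<phi> differentiable (at y)" and U: "open U" "xbar \<in> U"
    and L: "L-lipschitz_on U (gradient \<phi>)" and crit: "gradient \<phi> xbar = 0"
    and mr: "metrically_regular (gradient_map \<phi>) xbar 0"
    and ss: "semismooth_star (gradient_map \<phi>) xbar 0"
    and \<epsilon>: "\<epsilon> > 0"
  obtains \<delta> where "\<delta> > 0" "\<And>x d. x \<in> ball xbar \<delta> \<Longrightarrow> x \<noteq> xbar \<Longrightarrow> newton_direction \<phi> x d \<Longrightarrow>
      norm (x + d - xbar) \<le> \<epsilon> * norm (x - xbar)"
proof -
  let ?F = "gradient \<phi>" and ?G = "gradient_map \<phi>"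
  have G: "?G y = {?F y}" if "y \<in> U" for y
    using diff[OF that] by (rule gradient_map_eq)
  have der: "GDERIV \<phi> y :> ?F y" if "y \<in> U" for y
    using diff[OF that] by (rule GDERIV_gradient)
  from mr crit have "metrically_regular ?G xbar (?F xbar)" by simp
  from metric_regularity_local_solvability[OF this G U lipschitz_on_continuous_on[OF L]]
  obtain \<mu> W where \<mu>: "\<mu> > 0" and W: "open W" "xbar \<in> W" "W \<subseteq> U"
    and solv: "\<And>x. x \<in> W \<Longrightarrow> \<forall>\<^sub>F y in nhds (?F x). \<exists>x'. y \<in> ?G x' \<and> dist x x' \<le> \<mu> * dist y (?F x)"
    by blast
  have GW: "?G y = {?F y}" if "y \<in> W" for y
    using that W(3) by (intro G) auto
  have LW: "L-lipschitz_on W ?F"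
    using L W(3) by (rule lipschitz_on_subset)
  define e where "e = \<epsilon> / (2 * \<mu>)"
  have e: "e > 0" "\<mu> * (2 * e) = \<epsilon>"
    using \<epsilon> \<mu> by (auto simp: e_def)
  from ss crit have "semismooth_star ?G xbar (?F xbar)" by simp
  from semismooth_star_uniform_estimate[OF GW W(1,2) LW this e(1)]
  obtain \<delta> where \<delta>: "\<delta> > 0" "ball xbar \<delta> \<subseteq> W"
    and est: "\<And>x z u. x \<in> ball xbar \<delta> \<Longrightarrow> norm z = 1 \<Longrightarrow>
       u \<in> regular_subdifferential (\<lambda>y. inner z (?F y)) x \<Longrightarrow>
       \<bar>inner u (x - xbar) - inner z (?F x - ?F xbar)\<bar> \<le> e * norm (x - xbar)"
    by blast
  have L\<delta>: "L-lipschitz_on (ball xbar \<delta>) ?F"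
    using LW \<delta>(2) by (rule lipschitz_on_subset)
  have "norm (x + d - xbar) \<le> \<epsilon> * norm (x - xbar)"
    if x: "x \<in> ball xbar \<delta>" "x \<noteq> xbar" and d: "newton_direction \<phi> x d" for x d
  proof -
    from increments_along_ray[OF L\<delta> e(1) est x]
    obtain R where R: "R > 0" "ball x R \<subseteq> ball xbar \<delta>"
      and incr: "\<And>a t. t > 0 \<Longrightarrow> a \<in> ball x R \<Longrightarrow> a + t *\<^sub>R (x - xbar) \<in> ball x R \<Longrightarrow>
        norm (?F (a + t *\<^sub>R (x - xbar)) - ?F a - t *\<^sub>R (?F x - ?F xbar)) \<le> t * (2 * e * norm (x - xbar))"
      by blast
    have "(2 * e * norm (x - xbar))-lipschitz_on (ball x (R / 2))
        (\<lambda>y. inner (x - xbar) (?F y) - inner (?F x) y)"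
      by (rule lipschitz_directional_derivative)
        (use R \<delta>(2) W(3) der incr e crit in \<open>auto simp: subset_iff\<close>)
    from newton_step_bound[OF GW W(1) _ LW \<mu> solv _ this]
    have "norm ((x - xbar) + d) \<le> \<mu> * (2 * e * norm (x - xbar))"
      using x \<delta>(2) R(1) d by (auto simp: newton_direction_def)
    also have "\<dots> = \<epsilon> * norm (x - xbar)"
      using e(2) by (metis mult.assoc)
    finally show ?thesis
      by (simp add: algebra_simps)
  qed
  with \<delta>(1) that show ?thesis by blast
qed

text \<open>Makes the contraction estimate applicable with \<open>d = 0\<close> at every critical point \<open>x \<noteq> xbar\<close>, where it
  would give \<open>\<parallel>x - xbar\<parallel> \<le> \<epsilon> \<parallel>x - xbar\<parallel>\<close>. For \<open>\<epsilon> < 1\<close> this is impossible, so \<open>xbar\<close> is an isolated critical point.\<close>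

lemma zero_newton_direction:
  assumes "gradient \<phi> x = 0"
  shows "newton_direction \<phi> x 0"
proof -
  have "0 \<in> regular_subdifferential (\<lambda>y. 0) x"
    by (simp add: regular_subdifferential_def)
  then have "0 \<in> limiting_subdifferential (\<lambda>y. 0) x"
    using limiting_subdifferential_iff_nearby[of 0 UNIV "\<lambda>y. 0" x 0] by (auto simp: lipschitz_on_def)
  then show ?thesis
    using assms by (simp add: newton_direction_def)
qed

lemma newton_run_contracts:
  assumes step: "\<And>x d. x \<in> ball xbar r \<Longrightarrow> x \<noteq> xbar \<Longrightarrow> newton_direction \<phi> x d \<Longrightarrow>
      norm (x + d - xbar) \<le> 1 / 2 * norm (x - xbar)"
    and crit: "gradient \<phi> xbar = 0" and x0: "x0 \<in> ball xbar r"
    and run: "newton_run \<phi> x0 x d N" and k: "enat k \<le> N"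
  shows "norm (x k - xbar) \<le> (1 / 2) ^ k * norm (x0 - xbar) \<and> x k \<in> ball xbar r"
  using k
proof (induction k)
  case 0
  then show ?case
    using run x0 by (simp add: newton_run_def)
next
  case (Suc k)
  then have kN: "enat k < N"
    by (meson Suc_ile_eq)
  then have IH: "norm (x k - xbar) \<le> (1 / 2) ^ k * norm (x0 - xbar)" "x k \<in> ball xbar r"
    using Suc.IH by auto
  have "gradient \<phi> (x k) \<noteq> 0" "newton_direction \<phi> (x k) (d k)" "x (Suc k) = x k + d k"
    using run kN by (auto simp: newton_run_def)
  then have "norm (x (Suc k) - xbar) \<le> 1 / 2 * norm (x k - xbar)"
    using step[OF IH(2)] crit by metis
  then show ?case
    using IH norm_ge_zero[of "x k - xbar"]
    unfolding mem_ball dist_norm norm_minus_commute[of xbar] power_Suc by linarith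
qed

lemma Q_superlinear_of_contraction:
  assumes step: "\<And>\<epsilon>::real. \<epsilon> > 0 \<Longrightarrow> \<exists>\<delta>>0. \<forall>k. x k \<in> ball xbar \<delta> \<longrightarrow>
      norm (x (Suc k) - xbar) \<le> \<epsilon> * norm (x k - xbar)"
    and lim: "x \<longlonglongrightarrow> xbar"
  shows "Q_superlinear x xbar"
  unfolding Q_superlinear_def
proof (intro conjI lim tendstoI)
  fix \<epsilon> :: real assume \<epsilon>: "\<epsilon> > 0"
  then obtain \<delta> where \<delta>: "\<delta> > 0"
      "\<And>k. x k \<in> ball xbar \<delta> \<Longrightarrow> norm (x (Suc k) - xbar) \<le> \<epsilon> / 2 * norm (x k - xbar)"
    using step[of "\<epsilon> / 2"] by auto
  from tendstoD[OF lim \<delta>(1)]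
  show "\<forall>\<^sub>F k in sequentially. dist (norm (x (Suc k) - xbar) / norm (x k - xbar)) 0 < \<epsilon>"
  proof eventually_elim
    case (elim k)
    have "norm (x (Suc k) - xbar) / norm (x k - xbar) \<le> \<epsilon> / 2"
      using \<delta>(2)[of k] elim \<epsilon> by (cases "x k = xbar") (auto simp: dist_commute pos_divide_le_eq)
    also have "\<dots> < \<epsilon>"
      using \<epsilon> by simp
    finally show ?case
      by simp
  qed
qed

theorem theorem5p7:
  fixes \<phi> :: "real ^ 'n \<Rightarrow> real" and xbar :: "real ^ 'n"
  assumes "C11_around \<phi> xbar"
    and "gradient \<phi> xbar = 0"
    and "\<exists>U' V'. open U' \<and> xbar \<in> U' \<and> open V' \<and> 0 \<in> V' \<and>
           (\<forall>x\<in>U'. \<phi> differentiable (at x) \<longrightarrow> gradient \<phi> x \<in> V' \<longrightarrow>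
              (\<exists>d. - gradient \<phi> x \<in> second_subdifferential \<phi> x d))"
    and "metrically_regular (gradient_map \<phi>) xbar 0"
    and "semismooth_star (gradient_map \<phi>) xbar 0"
  shows "\<exists>U. open U \<and> xbar \<in> U \<and>
           (\<forall>x0\<in>U.
              newton_well_defined \<phi> x0 \<and>
              (\<forall>x d. \<forall>K::nat. newton_run \<phi> x0 x d (enat K) \<longrightarrow> gradient \<phi> (x K) = 0 \<longrightarrow> x K = xbar) \<and>
              (\<forall>x d. newton_run \<phi> x0 x d \<infinity> \<longrightarrow> Q_superlinear x xbar))"
proof -
  note crit = assms(2)
  obtain U L where U: "open U" "xbar \<in> U" and diff: "\<And>y. y \<in> U \<Longrightarrow> \<phi> differentiable (at y)"
    and L: "L-lipschitz_on U (gradient \<phi>)"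
    using assms(1) unfolding C11_around_def by blast
  have contr: "\<exists>\<delta>>0. \<forall>x\<in>ball xbar \<delta>. \<forall>d. x \<noteq> xbar \<longrightarrow> newton_direction \<phi> x d \<longrightarrow>
      norm (x + d - xbar) \<le> \<epsilon> * norm (x - xbar)" if "\<epsilon> > 0" for \<epsilon>
    by (rule newton_contraction[OF diff U L crit assms(4,5) that]) blast+
  have C11: "C11_around \<phi> y" if "y \<in> U" for y
    unfolding C11_around_def using U(1) that diff L lipschitz_on_continuous_on[OF L] by blast
  obtain U' V' where U': "open U'" "xbar \<in> U'" and V': "open V'" "0 \<in> V'"
    and dir: "\<And>x. x \<in> U' \<Longrightarrow> \<phi> differentiable (at x) \<Longrightarrow> gradient \<phi> x \<in> V' \<Longrightarrow>
      \<exists>d. - gradient \<phi> x \<in> second_subdifferential \<phi> x d"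
    using assms(3) by blast
  obtain \<delta> where \<delta>: "\<delta> > 0" and half: "\<And>x d. x \<in> ball xbar \<delta> \<Longrightarrow> x \<noteq> xbar \<Longrightarrow> newton_direction \<phi> x d \<Longrightarrow>
      norm (x + d - xbar) \<le> 1 / 2 * norm (x - xbar)"
    using contr[of "1 / 2"] by auto
  have "open (ball xbar \<delta> \<inter> (U' \<inter> (U \<inter> gradient \<phi> -` V')))"
    using continuous_open_preimage[OF lipschitz_on_continuous_on[OF L] U(1) V'(1)] U' by auto
  moreover have "xbar \<in> ball xbar \<delta> \<inter> (U' \<inter> (U \<inter> gradient \<phi> -` V'))"
    using \<delta> U U' V' crit by auto
  ultimately obtain r where r: "r > 0" and sub: "ball xbar r \<subseteq> ball xbar \<delta> \<inter> (U' \<inter> (U \<inter> gradient \<phi> -` V'))"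
    by (meson open_contains_ball)
  have step: "norm (x + d - xbar) \<le> 1 / 2 * norm (x - xbar)"
    if "x \<in> ball xbar r" "x \<noteq> xbar" "newton_direction \<phi> x d" for x d
    using half that sub by blast
  have exists_dir: "\<exists>d. newton_direction \<phi> x d" if "x \<in> ball xbar r" for x
  proof -
    have x: "x \<in> U" "x \<in> U'" "gradient \<phi> x \<in> V'"
      using that sub by auto
    then obtain d where "- gradient \<phi> x \<in> coderivative (gradient_map \<phi>) (x, gradient \<phi> x) d"
      using dir[OF x(2) diff[OF x(1)] x(3)] by (auto simp: second_subdifferential_def)
    from coderivative_subset_subdifferential_scalarization[OF gradient_map_eq[OF diff] U(1) x(1) L this]
    show ?thesis
      by (auto simp: newton_direction_def)
  qed
  have isolated: "x = xbar" if "x \<in> ball xbar r" "gradient \<phi> x = 0" for x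
  proof (rule ccontr)
    assume "x \<noteq> xbar"
    then have "norm (x - xbar) \<le> 1 / 2 * norm (x - xbar)"
      using step[OF that(1) _ zero_newton_direction[OF that(2)]] by simp
    then show False
      using \<open>x \<noteq> xbar\<close> by simp
  qed
  show ?thesis
  proof (intro exI[of _ "ball xbar r"] conjI ballI allI impI)
    show "open (ball xbar r)" "xbar \<in> ball xbar r"
      using r by auto
    fix x0 assume x0: "x0 \<in> ball xbar r"
    have contracts: "norm (x k - xbar) \<le> (1 / 2) ^ k * norm (x0 - xbar) \<and> x k \<in> ball xbar r"
      if "newton_run \<phi> x0 x d N" "enat k \<le> N" for x d N k
      by (rule newton_run_contracts[where \<phi> = \<phi> and r = r and d = d and N = N])
        (use step crit x0 that in blast)+
    show "newton_well_defined \<phi> x0"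
      unfolding newton_well_defined_def
    proof (intro allI impI conjI)
      fix x d and K :: nat
      assume "newton_run \<phi> x0 x d (enat K)"
      from contracts[OF this, of K] have "x K \<in> ball xbar r" by simp
      then show "C11_around \<phi> (x K)" "\<exists>d'. newton_direction \<phi> (x K) d'"
        using C11 exists_dir sub by blast+
    qed
    show "x K = xbar" if "newton_run \<phi> x0 x d (enat K)" "gradient \<phi> (x K) = 0" for x d and K :: nat
      using contracts[OF that(1) order_refl] that(2) by (intro isolated) auto
    show "Q_superlinear x xbar" if run: "newton_run \<phi> x0 x d \<infinity>" for x d
    proof (rule Q_superlinear_of_contraction)
      have "(\<lambda>k. (1 / 2) ^ k * norm (x0 - xbar)) \<longlonglongrightarrow> 0"
        by (intro tendsto_mult_left_zero LIMSEQ_power_zero) simp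
      moreover have "norm (x k - xbar) \<le> (1 / 2) ^ k * norm (x0 - xbar)" for k
        using contracts[OF run, of k] by simp
      then have "\<forall>\<^sub>F k in sequentially. norm (x k - xbar) \<le> (1 / 2) ^ k * norm (x0 - xbar)"
        by simp
      ultimately have "(\<lambda>k. x k - xbar) \<longlonglongrightarrow> 0"
        by (rule Lim_null_comparison[rotated])
      then show "x \<longlonglongrightarrow> xbar"
        by (simp add: LIM_zero_iff)
      fix \<epsilon> :: real assume "\<epsilon> > 0"
      then obtain \<delta>' where "\<delta>' > 0" and \<delta>': "\<And>x d. x \<in> ball xbar \<delta>' \<Longrightarrow> x \<noteq> xbar \<Longrightarrow> newton_direction \<phi> x d \<Longrightarrow>
          norm (x + d - xbar) \<le> \<epsilon> * norm (x - xbar)"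
        using contr by blast
      have "norm (x (Suc k) - xbar) \<le> \<epsilon> * norm (x k - xbar)" if "x k \<in> ball xbar \<delta>'" for k
      proof -
        have "gradient \<phi> (x k) \<noteq> 0" "newton_direction \<phi> (x k) (d k)" "x (Suc k) = x k + d k"
          using run by (auto simp: newton_run_def)
        then show ?thesis
          using \<delta>'[OF that] crit by metis
      qed
      with \<open>\<delta>' > 0\<close> show "\<exists>\<delta>>0. \<forall>k. x k \<in> ball xbar \<delta> \<longrightarrow> norm (x (Suc k) - xbar) \<le> \<epsilon> * norm (x k - xbar)"
        by blast
    qed
  qed
qed

end
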